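(* Let $\mathcal{A}$ be a finite alphabet and let $\mathbf{p},\mathbf{q}$ be irreducible pairs on $\mathcal{A}$ which are piece-wise order reversing and have the same Type. If $\mathcal{P}(\mathbf{p})=\mathcal{P}(\mathbf{q})$ and $\mathcal{M}(\mathbf{p})=\mathcal{M}(\mathbf{q})$, then the non-labeled Rauzy classes of $\mathbf{p}$ and $\mathbf{q}$ coincide.
   Context: Let $n=\#\mathcal{A}\ge 2$. A pair is $\mathbf{p}=(p_0,p_1)$ with $p_0,p_1:\mathcal{A}\to\{1,\dots,n\}$ bijections (row $\varepsilon$ lists $p_\varepsilon^{-1}(1),\dots,p_\varepsilon^{-1}(n)$). Irreducible: $p_0^{-1}\{1,\dots,k\}\ne p_1^{-1}\{1,\dots,k\}$ for $1\le k<n$. Rauzy move of type $\varepsilon$: $\varepsilon\mathbf{p}=(p'_0,p'_1)$, $p'_\varepsilon=p_\varepsilon$, and for $z=p_\varepsilon^{-1}(n)$, $p'_{1-\varepsilon}(b)=p_{1-\varepsilon}(b)$ if $p_{1-\varepsilon}(b)\le p_{1-\varepsilon}(z)$, $=p_{1-\varepsilon}(b)+1$ if $p_{1-\varepsilon}(z)<p_{1-\varepsilon}(b)<n$, $=p_{1-\varepsilon}(z)+1$ if $p_{1-\varepsilon}(b)=n$. The labeled Rauzy class of $\mathbf{p}$ is the set of pairs reachable from $\mathbf{p}$ by Rauzy moves; the non-labeled Rauzy class is its image under $(p_0,p_1)\mapsto p_1\circ p_0^{-1}\in\mathfrak{S}_n$. Invariants: define $\mathcal{S}(\mathbf{p}):\mathcal{A}\to\mathcal{A}$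 by $\mathcal{S}(\mathbf{p})(\alpha)=p_0^{-1}(1)$ if $p_1(\alpha)=1$; $=p_0^{-1}(p_0(p_1^{-1}(n))+1)$ if $p_1(\alpha)=p_1(p_0^{-1}(n))+1$; $=p_0^{-1}(p_0(p_1^{-1}(p_1(\alpha)-1))+1)$ otherwise. $\mathcal{M}(\mathbf{p})$ is the length of the cycle of the permutation $\mathcal{S}(\mathbf{p})$ containing $p_0^{-1}(1)$. Let $\mathcal{Y}(\mathbf{p})$ be the first return map of $\mathcal{S}(\mathbf{p})$ to $\mathcal{A}\setminus\{p_0^{-1}(1)\}$ (i.e. $\mathcal{Y}(\mathbf{p})(b)=\mathcal{S}(\mathbf{p})^2(b)$ if $p_1(b)=1$, $\mathcal{S}(\mathbf{p})(b)$ otherwise), and $\mathcal{P}(\mathbf{p})$ the unordered list (with multiplicity) of cycle lengths of $\mathcal{Y}(\mathbf{p})$. Standard: $p_0^{-1}(1)=p_1^{-1}(n)$, $p_1^{-1}(1)=p_0^{-1}(n)$. A standard pair is piece-wise order reversing if there are $2=k_0<\dots<k_\ell=n$ with $B_i=p_0^{-1}\{k_{i-1},\dots,k_i-1\}=p_1^{-1}\{k_{i-1},\dots,k_i-1\}$ and $p_0(b)+p_1(b)=k_{i-1}+k_i-1$ for $b\in B_i$; the $B_i$ are blocks, a block of $k$ letters is a $k$-block. Chains: with the $1$-blocks $S_1,\dots,S_{k-1}$ listed left to right, chain $C_i$ is the possibly empty sequence of consecutive blocks strictly between $S_{i-1}$ and $S_i$ ($C_1$ before $S_1$, $C_k$ after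 $S_{k-1}$). Types: $\langle1\rangle$: at most one nonempty chain, consisting (if present) of exactly one block. Types $\langle2\rangle$–$\langle5\rangle$ require more than one block of size $\ge2$, and: $\langle2\rangle$: all nonempty chains consist of $2$-blocks; $\langle3\rangle$: each nonempty chain is (i) $m$ $2$-blocks, a $3$-block, $\ell$ $2$-blocks ($m,\ell\ge0$) or (ii) $m\ge1$ $2$-blocks, with at least one chain of form (i); $\langle4\rangle$: exactly one chain is a $4$-block followed by $m\ge0$ $2$-blocks, all other nonempty chains consist of $2$-blocks; $\langle5\rangle$: exactly one chain is a single $5$-block, every other nonempty chain is exactly one $2$-block. *)

theory Defs
  imports Main "HOL-Library.Multiset" "HOL-Library.Cardinality"
begin

text \<open>Pairs over a finite alphabet given by the finite type 'a; n = CARD('a).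
  Row e of the pair is the bijection p_e : 'a -> {1..n}.\<close>

type_synonym 'a pair = "('a \<Rightarrow> nat) \<times> ('a \<Rightarrow> nat)"

definition is_pair :: "'a::finite pair \<Rightarrow> bool" where
  "is_pair p \<longleftrightarrow> bij_betw (fst p) UNIV {1..CARD('a)} \<and> bij_betw (snd p) UNIV {1..CARD('a)}"

definition irreducible :: "'a::finite pair \<Rightarrow> bool" where
  "irreducible p \<longleftrightarrow> is_pair p \<and>
     (\<forall>k. 1 \<le> k \<and> k < CARD('a) \<longrightarrow>
        {a. fst p a \<in> {1..k}} \<noteq> {a. snd p a \<in> {1..k}})"

definition move_row :: "('a::finite \<Rightarrow> nat) \<Rightarrow> ('a \<Rightarrow> nat) \<Rightarrow> ('a \<Rightarrow> nat)" where
  "move_row q r = (let z = inv q CARD('a) in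
     (\<lambda>b. if r b \<le> r z then r b
          else if r b < CARD('a) then r b + 1
          else r z + 1))"

definition rauzy0 :: "'a::finite pair \<Rightarrow> 'a pair" where
  "rauzy0 p = (fst p, move_row (fst p) (snd p))"

definition rauzy1 :: "'a::finite pair \<Rightarrow> 'a pair" where
  "rauzy1 p = (move_row (snd p) (fst p), snd p)"

definition rauzy_step :: "'a::finite pair \<Rightarrow> 'a pair \<Rightarrow> bool" where
  "rauzy_step p q \<longleftrightarrow> q = rauzy0 p \<or> q = rauzy1 p"

definition labeled_rauzy_class :: "'a::finite pair \<Rightarrow> 'a pair set" where
  "labeled_rauzy_class p = {q. rauzy_step\<^sup>*\<^sup>* p q}"

definition unlabel :: "'a::finite pair \<Rightarrow> (nat \<Rightarrow> nat)" where
  "unlabel p = (\<lambda>k. if k \<in> {1..CARD('a)} then snd p (inv (fst p) k) else k)"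

definition nonlabeled_rauzy_class :: "'a::finite pair \<Rightarrow> (nat \<Rightarrow> nat) set" where
  "nonlabeled_rauzy_class p = unlabel ` labeled_rauzy_class p"

definition S_perm :: "'a::finite pair \<Rightarrow> 'a \<Rightarrow> 'a" where
  "S_perm p = (let p0 = fst p; p1 = snd p; n = CARD('a) in
     (\<lambda>\<alpha>. if p1 \<alpha> = 1 then inv p0 1
          else if p1 \<alpha> = p1 (inv p0 n) + 1 then inv p0 (p0 (inv p1 n) + 1)
          else inv p0 (p0 (inv p1 (p1 \<alpha> - 1)) + 1)))"

definition orbit_of :: "('b \<Rightarrow> 'b) \<Rightarrow> 'b \<Rightarrow> 'b set" where
  "orbit_of f x = {(f ^^ k) x | k. True}"

definition M_inv :: "'a::finite pair \<Rightarrow> nat" where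
  "M_inv p = card (orbit_of (S_perm p) (inv (fst p) 1))"

definition Y_map :: "'a::finite pair \<Rightarrow> 'a \<Rightarrow> 'a" where
  "Y_map p = (\<lambda>b. if snd p b = 1 then S_perm p (S_perm p b) else S_perm p b)"

definition P_inv :: "'a::finite pair \<Rightarrow> nat multiset" where
  "P_inv p = image_mset card
     (mset_set {orbit_of (Y_map p) b | b. b \<noteq> inv (fst p) 1})"

definition standard :: "'a::finite pair \<Rightarrow> bool" where
  "standard p \<longleftrightarrow> inv (fst p) 1 = inv (snd p) CARD('a) \<and> inv (snd p) 1 = inv (fst p) CARD('a)"

definition pwor_cuts :: "'a::finite pair \<Rightarrow> nat list \<Rightarrow> bool" where
  "pwor_cuts p ks \<longleftrightarrow> ks \<noteq> [] \<and> hd ks = 2 \<and> last ks = CARD('a) \<and> sorted_wrt (<) ks \<and>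
     (\<forall>i. 1 \<le> i \<and> i < length ks \<longrightarrow>
        {b. fst p b \<in> {ks!(i-1)..<ks!i}} = {b. snd p b \<in> {ks!(i-1)..<ks!i}} \<and>
        (\<forall>b. fst p b \<in> {ks!(i-1)..<ks!i} \<longrightarrow> fst p b + snd p b = ks!(i-1) + ks!i - 1))"

definition pwor :: "'a::finite pair \<Rightarrow> bool" where
  "pwor p \<longleftrightarrow> standard p \<and> (\<exists>ks. pwor_cuts p ks)"

definition block_sizes :: "nat list \<Rightarrow> nat list" where
  "block_sizes ks = map (\<lambda>i. ks!i - ks!(i-1)) [1..<length ks]"

fun chains :: "nat list \<Rightarrow> nat list list" where
  "chains [] = [[]]"
| "chains (x # xs) = (if x = 1 then [] # chains xs
                      else (x # hd (chains xs)) # tl (chains xs))"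

definition type_of_sizes :: "nat \<Rightarrow> nat list \<Rightarrow> bool" where
  "type_of_sizes t L = (let cs = chains L;
       big = length (filter (\<lambda>s. 2 \<le> s) L);
       formI = (\<lambda>c. \<exists>m l. c = replicate m 2 @ [3] @ replicate l 2);
       formII = (\<lambda>c. \<exists>m\<ge>1. c = replicate m (2::nat)) in
     (t = 1 \<and> length (filter (\<lambda>c. c \<noteq> []) cs) \<le> 1 \<and> (\<forall>c\<in>set cs. c \<noteq> [] \<longrightarrow> length c = 1)) \<or>
     (t = 2 \<and> 1 < big \<and> (\<forall>c\<in>set cs. \<forall>s\<in>set c. s = 2)) \<or>
     (t = 3 \<and> 1 < big \<and> (\<forall>c\<in>set cs. c \<noteq> [] \<longrightarrow> formI c \<or> formII c) \<and> (\<exists>c\<in>set cs. formI c)) \<or>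
     (t = 4 \<and> 1 < big \<and> (\<exists>i<length cs. (\<exists>m. cs!i = 4 # replicate m 2) \<and>
            (\<forall>j<length cs. j \<noteq> i \<longrightarrow> (\<forall>s\<in>set (cs!j). s = 2)))) \<or>
     (t = 5 \<and> 1 < big \<and> (\<exists>i<length cs. cs!i = [5] \<and>
            (\<forall>j<length cs. j \<noteq> i \<longrightarrow> cs!j = [] \<or> cs!j = [2]))))"

definition has_type :: "nat \<Rightarrow> 'a::finite pair \<Rightarrow> bool" where
  "has_type t p \<longleftrightarrow> pwor p \<and> (\<exists>ks. pwor_cuts p ks \<and> type_of_sizes t (block_sizes ks))"

end

theory Submission
  imports Defs
begin

text \<open>Four rotations, alternately of the bottom and the top row, join two standard pairs that differ by the exchange
  \<open>X s Y s' W \<mapsto> Y s' X s W\<close>, carried out simultaneously in both rows between the outer letters; here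
  the letters \<open>s, s'\<close> occur in the same order in both rows, but the words cut off by them need not
  contain the same letters in the two rows. This exchange is an involution and all further moves are compositions of
  exchanges: it permutes all chains except the last one, reverses the order of the blocks in a front
  segment that is followed by a 1-block, trades the 2-blocks preceding two 3-blocks, and carries
  4-blocks and 5-blocks from one chain to another.

  On the other hand, prepending a block of size \<open>k\<close> acts on the cycles of \<open>Y\<close> by inserting
  \<open>k\<close> letters (\<open>k\<close> even) or \<open>(k - 1) / 2\<close> letters (\<open>k\<close> odd) into the cycle through the first
  letter, and for odd \<open>k\<close> the remaining letters form a new cycle. So the invariants can be read off
  from the block sizes, and for each type they determine the arrangement up to the moves above.\<close>

subsection \<open>Exchange moves on pairs of words\<close>

text \<open>The last chain is the obstacle: no 1-block follows it, so permuting chains never moves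
  it. It is controlled through M, which is one more than the length of the cycle through the last
  letter. For Types 1 and 2 this length fixes the last chain, and permuting the others suffices. For
  Type 3, if the last chain has a 3-block, it fixes only the number of 2-blocks after it; for Types
  4 and 5 it cannot tell a 4-block followed by m 2-blocks from m + 2 2-blocks, nor a 5-block from a
  2-block. These ambiguities are why there are special moves that alter the last chain together with
  an earlier one. The moves also change which letters share a block. Arrangements with equal block
  sizes therefore agree only up to a relabelling, which is harmless for non-labeled classes.\<close>

inductive swap :: "'a list \<times> 'a list \<Rightarrow> 'a list \<times> 'a list \<Rightarrow> bool" where
  "swap (X @ s # Y @ s' # W, X' @ s # Y' @ s' # W') (Y @ s' # X @ s # W, Y' @ s' # X' @ s # W')"

lemma swapI:
  assumes "t = X @ s # Y @ s' # W" "b = X' @ s # Y' @ s' # W'"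
    "t' = Y @ s' # X @ s # W" "b' = Y' @ s' # X' @ s # W'"
  shows "swap (t, b) (t', b')"
  unfolding assms by (rule swap.intros)

lemma swap_rtranclpI:
  assumes "swap\<^sup>*\<^sup>* (Y @ s' # X @ s # W, Y' @ s' # X' @ s # W') r"
    and "t = X @ s # Y @ s' # W" "b = X' @ s # Y' @ s' # W'"
  shows "swap\<^sup>*\<^sup>* (t, b) r"
  using assms by (metis converse_rtranclp_into_rtranclp swap.intros)

lemma symp_swap: "symp swap"
  by (rule sympI) (auto elim!: swap.cases intro: swap.intros)

lemma swap_map: "swap p q \<Longrightarrow> swap (map_prod (map f) (map f) p) (map_prod (map f) (map f) q)"
  by (induction rule: swap.induct) (auto intro: swap.intros)

lemma swaps_map:
  "swap\<^sup>*\<^sup>* p q \<Longrightarrow> swap\<^sup>*\<^sup>* (map_prod (map f) (map f) p) (map_prod (map f) (map f) q)"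
  by (induction rule: rtranclp_induct) (auto intro: swap_map rtranclp.rtrancl_into_rtrancl)

lemma swap_mset: "swap p q \<Longrightarrow> mset (fst p) = mset (fst q) \<and> mset (snd p) = mset (snd q)"
  by (induction rule: swap.induct) auto

section \<open>Moves between lists of block sizes\<close>

definition block_words :: "'a list list \<Rightarrow> 'a list \<times> 'a list" where
  "block_words bs = (concat bs, concat (map rev bs))"

text \<open>Only sizes are compared, so a move has to be available whatever the letters are. The
  type \<open>nat\<close> serves as a universal alphabet, into which every finite type
  injects.\<close>

definition conn :: "nat list \<Rightarrow> nat list \<Rightarrow> bool" where
  "conn L L' \<longleftrightarrow> (\<forall>bs :: nat list list. map length bs = L \<longrightarrow>
     (\<exists>bs'. map length bs' = L' \<and> swap\<^sup>*\<^sup>* (block_words bs) (block_words bs')))"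

lemma connI:
  assumes "\<And>bs :: nat list list. map length bs = L \<Longrightarrow>
     \<exists>bs'. map length bs' = L' \<and>
       swap\<^sup>*\<^sup>* (concat bs, concat (map rev bs)) (concat bs', concat (map rev bs'))"
  shows "conn L L'"
  using assms unfolding conn_def block_words_def by blast

lemma conn_refl [simp]: "conn L L"
  unfolding conn_def by blast

lemma conn_trans [trans]: "conn L L' \<Longrightarrow> conn L' L'' \<Longrightarrow> conn L L''"
  unfolding conn_def
proof (intro allI impI)
  fix bs :: "nat list list"
  assume *: "\<forall>bs :: nat list list. map length bs = L \<longrightarrow>
      (\<exists>bs'. map length bs' = L' \<and> swap\<^sup>*\<^sup>* (block_words bs) (block_words bs'))"
    "\<forall>bs :: nat list list. map length bs = L' \<longrightarrow>
      (\<exists>bs'. map length bs' = L'' \<and> swap\<^sup>*\<^sup>* (block_words bs) (block_words bs'))"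
    "map length bs = L"
  then obtain bs' where 1: "map length bs' = L'" "swap\<^sup>*\<^sup>* (block_words bs) (block_words bs')"
    by blast
  with * obtain bs'' where 2: "map length bs'' = L''" "swap\<^sup>*\<^sup>* (block_words bs') (block_words bs'')"
    by blast
  from rtranclp_trans[OF 1(2) 2(2)] 2(1)
  show "\<exists>bs'. map length bs' = L'' \<and> swap\<^sup>*\<^sup>* (block_words bs) (block_words bs')" by blast
qed

lemma length_one_conv: "length xs = 1 \<longleftrightarrow> (\<exists>x. xs = [x])"
  by (cases xs) auto

lemma length_two_conv: "length xs = 2 \<longleftrightarrow> (\<exists>x y. xs = [x, y])"
  by (auto simp: numeral_eq_Suc length_Suc_conv)

lemma length_three_conv: "length xs = 3 \<longleftrightarrow> (\<exists>x y z. xs = [x, y, z])"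
  by (auto simp: numeral_eq_Suc length_Suc_conv)

lemma length_four_conv: "length xs = 4 \<longleftrightarrow> (\<exists>x y z u. xs = [x, y, z, u])"
  by (auto simp: numeral_eq_Suc length_Suc_conv)

lemma length_five_conv: "length xs = 5 \<longleftrightarrow> (\<exists>x y z u v. xs = [x, y, z, u, v])"
  by (auto simp: numeral_eq_Suc length_Suc_conv)

lemmas length_conv_aux =
  length_one_conv[unfolded One_nat_def] length_two_conv length_three_conv length_four_conv length_five_conv

lemmas length_conv = length_conv_aux length_conv_aux[THEN trans[OF eq_commute]]
  map_eq_append_conv map_eq_Cons_conv append_eq_map_conv Cons_eq_map_conv

text \<open>If both cut letters are 1-blocks, the two rows cut off the same blocks, and an exchange
  moves whole groups of chains.\<close>

lemma conn_rotate: "conn (X @ 1 # Y @ 1 # W) (Y @ 1 # X @ 1 # W)"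
proof (rule connI)
  fix bs :: "nat list list"
  assume "map length bs = X @ 1 # Y @ 1 # W"
  then obtain bX s bY s' bW where bs: "bs = bX @ [s] # bY @ [s'] # bW"
    and len: "map length bX = X" "map length bY = Y" "map length bW = W"
    by (auto simp: length_conv)
  have "swap (concat bs, concat (map rev bs))
      (concat (bY @ [s'] # bX @ [s] # bW), concat (map rev (bY @ [s'] # bX @ [s] # bW)))"
    unfolding bs by (simp, rule swap.intros)
  with len show "\<exists>bs'. map length bs' = Y @ 1 # X @ 1 # W \<and>
       swap\<^sup>*\<^sup>* (concat bs, concat (map rev bs)) (concat bs', concat (map rev bs'))"
    by (intro exI[of _ "bY @ [s'] # bX @ [s] # bW"] conjI r_into_rtranclp) auto
qed

text \<open>The first letter \<open>a\<close> is exchanged with the first letter of each later block in turn and finally with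
  the 1-block \<open>s\<close>; this shifts every block boundary by one letter and reverses the order of the blocks.\<close>

lemma swaps_reverse:
  assumes "\<forall>b\<in>set bs. b \<noteq> []"
  shows "\<exists>bs'. map length bs' = rev (map length bs) @ [Suc (length Z)] \<and>
    swap\<^sup>*\<^sup>* (P @ a # Z @ concat bs @ s # W, rev Z @ P' @ a # concat (map rev bs) @ s # W')
      (concat bs' @ P @ a # W, concat (map rev bs') @ P' @ a # W')"
  using assms
proof (induction bs arbitrary: P P' Z)
  case Nil
  have "swap (P @ a # Z @ s # W, rev Z @ P' @ a # s # W')
     (Z @ s # P @ a # W, s # rev Z @ P' @ a # W')"
    by (rule swapI[of _ P a Z s W _ "rev Z @ P'" "[]" W']) simp_all
  then show ?case by (intro exI[of _ "[Z @ [s]]"]) auto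
next
  case (Cons b bs)
  then obtain c Y where b: "b = c # Y" by (cases b) auto
  from Cons obtain bs' where len: "map length bs' = rev (map length bs) @ [Suc (length Y)]"
    and *: "swap\<^sup>*\<^sup>* ((Z @ c # P) @ a # Y @ concat bs @ s # W,
        rev Y @ (c # rev Z @ P') @ a # concat (map rev bs) @ s # W')
      (concat bs' @ (Z @ c # P) @ a # W, concat (map rev bs') @ (c # rev Z @ P') @ a # W')"
    by (metis list.set_intros(2))
  have "swap\<^sup>*\<^sup>* (P @ a # Z @ concat (b # bs) @ s # W,
      rev Z @ P' @ a # concat (map rev (b # bs)) @ s # W')
      (concat bs' @ (Z @ c # P) @ a # W, concat (map rev bs') @ (c # rev Z @ P') @ a # W')"
    by (rule swap_rtranclpI[where X = P and s = a and Y = Z and s' = c and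
          X' = "rev Z @ P'" and Y' = "rev Y"]) (use * b in simp_all)
  with len show ?case by (intro exI[of _ "bs' @ [Z @ [c]]"]) (auto simp: b)
qed

text \<open>Started with empty \<open>P\<close> and \<open>P'\<close>, the shifting puts
  \<open>s\<close> at the end of the first new block and leaves \<open>a\<close> as the new 1-block.
  Positive sizes provide every block with a first letter to shift.\<close>

lemma conn_reverse:
  assumes "0 \<notin> set L"
  shows "conn (L @ 1 # W) (rev L @ 1 # W)"
proof (rule connI)
  fix bs :: "nat list list"
  assume "map length bs = L @ 1 # W"
  then obtain bL s bW where bs: "bs = bL @ [s] # bW"
    and len: "map length bL = L" "map length bW = W"
    by (auto simp: length_conv)
  show "\<exists>bs'. map length bs' = rev L @ 1 # W \<and>
       swap\<^sup>*\<^sup>* (concat bs, concat (map rev bs)) (concat bs', concat (map rev bs'))"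
  proof (cases bL)
    case Nil
    with len bs show ?thesis by (intro exI[of _ bs]) auto
  next
    case (Cons b bL')
    have ne: "\<forall>b\<in>set bL. b \<noteq> []" using assms len by force
    with Cons obtain a Z where b: "b = a # Z" by (cases b) auto
    from swaps_reverse[of bL' Z "[]" a s "concat bW" "[]" "concat (map rev bW)"] ne Cons
    obtain bs' where "map length bs' = rev (map length bL') @ [Suc (length Z)]"
      "swap\<^sup>*\<^sup>* (concat bs, concat (map rev bs))
        (concat bs' @ a # concat bW, concat (map rev bs') @ a # concat (map rev bW))"
      by (auto simp: bs b)
    with len Cons b show ?thesis by (intro exI[of _ "bs' @ [a] # bW"]) auto
  qed
qed

text \<open>The letters of the 2-blocks are cycled through the 3-letter frame, which leaves a 3-block behind them.\<close>

lemma swaps_unnest_aux: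
  assumes "map length bs = replicate k 2" "map length es = replicate i 2"
  shows "\<exists>es' q'. map length es' = replicate (i + k) 2 \<and>
    swap\<^sup>*\<^sup>* (q # concat es @ r # w # y # concat bs @ u # V,
        concat (map rev es) @ r # u # y # q # concat (map rev bs) @ w # V')
      (concat es' @ r # w # q' # y # u # V, w # concat (map rev es') @ r # u # y # q' # V')"
  using assms
proof (induction bs arbitrary: es q i k)
  case Nil
  have "swap (q # concat es @ r # w # y # u # V, concat (map rev es) @ r # u # y # q # w # V')
      (concat es @ r # w # q # y # u # V, w # concat (map rev es) @ r # u # y # q # V')"
    by (rule swapI[of _ "[]" q "concat es @ [r]" w "y # u # V" _
          "concat (map rev es) @ r # u # [y]" "[]" V']) simp_all
  with Nil show ?case by (intro exI[of _ es] exI[of _ q]) auto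
next
  case (Cons b bs)
  from Cons.prems obtain k' c d where k: "k = Suc k'" "map length bs = replicate k' 2" and b: "b = [c, d]"
    by (cases k) (auto simp: length_conv)
  have "map length ([d, q] # es) = replicate (Suc i) 2" using Cons.prems by simp
  from Cons.IH[OF k(2) this, of c] obtain es' q' where
    len: "map length es' = replicate (Suc i + k') 2" and
    *: "swap\<^sup>*\<^sup>* (c # concat ([d, q] # es) @ r # w # y # concat bs @ u # V,
        concat (map rev ([d, q] # es)) @ r # u # y # c # concat (map rev bs) @ w # V')
      (concat es' @ r # w # q' # y # u # V, w # concat (map rev es') @ r # u # y # q' # V')"
    by blast
  have "swap\<^sup>*\<^sup>* (q # concat es @ r # w # y # concat (b # bs) @ u # V,
        concat (map rev es) @ r # u # y # q # concat (map rev (b # bs)) @ w # V')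
      (concat es' @ r # w # q' # y # u # V, w # concat (map rev es') @ r # u # y # q' # V')"
    by (rule swap_rtranclpI[where X = "q # concat es @ r # [w]" and s = y and Y = "[c]" and s' = d and
          X' = "concat (map rev es) @ r # [u]" and Y' = "[q]"]) (use * b in simp_all)
  with len k show ?case by (intro exI[of _ es'] exI[of _ q'] conjI) simp_all
qed

text \<open>The letter \<open>w\<close> leads the bottom word but belongs to the end of the top
  word. One exchange at \<open>f\<close> and \<open>r\<close> brings it next to \<open>f\<close>, so
  that the 2-block \<open>[f, w]\<close> splits off on the right; now \<open>e\<close> leads the
  bottom word and takes over the role of \<open>w\<close>.\<close>

lemma swaps_rotate_pairs:
  assumes "map length es = replicate i 2"
  shows "\<exists>fs. map length fs = replicate (Suc i) 2 \<and>
    swap\<^sup>*\<^sup>* (concat es @ r # w # V, w # concat (map rev es) @ r # V')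
      (concat fs @ V, concat (map rev fs) @ V')"
  using assms
proof (induction es arbitrary: i w V V')
  case Nil
  then show ?case by (intro exI[of _ "[[r, w]]"]) auto
next
  case (Cons b es)
  from Cons.prems obtain i' e f where i: "i = Suc i'" "map length es = replicate i' 2" and b: "b = [e, f]"
    by (cases i) (auto simp: length_conv)
  from Cons.IH[OF i(2), of e "f # w # V" "w # f # V'"] obtain fs where
    len: "map length fs = replicate (Suc i') 2" and
    *: "swap\<^sup>*\<^sup>* (concat es @ r # e # f # w # V, e # concat (map rev es) @ r # w # f # V')
      (concat fs @ f # w # V, concat (map rev fs) @ w # f # V')"
    by blast
  have "swap\<^sup>*\<^sup>* (concat (b # es) @ r # w # V, w # concat (map rev (b # es)) @ r # V')
      (concat fs @ f # w # V, concat (map rev fs) @ w # f # V')"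
    by (rule swap_rtranclpI[where X = "[e]" and s = f and Y = "concat es" and s' = r and
          X' = "[w]" and Y' = "e # concat (map rev es)"]) (use * b in simp_all)
  with len i show ?case
    by (intro exI[of _ "fs @ [[f, w]]"]) (auto simp flip: replicate_append_same)
qed

text \<open>The frame \<open>w\<close>, \<open>y\<close>, \<open>u\<close> is a 3-block torn open:
  its outer letters are interchanged between the rows as they should be, but 2-blocks stand between
  its second and third place.\<close>

lemma swaps_unnest:
  assumes "map length bs = replicate k 2"
  shows "\<exists>bs'. map length bs' = replicate k 2 @ [3] \<and>
    swap\<^sup>*\<^sup>* (w # y # concat bs @ u # V, u # y # concat (map rev bs) @ w # V')
      (concat bs' @ V, concat (map rev bs') @ V')"
proof (cases bs)
  case Nil
  with assms show ?thesis by (intro exI[of _ "[[w, y, u]]"]) auto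
next
  case (Cons b bs1)
  from Cons assms obtain k' c d where k: "k = Suc k'" "map length bs1 = replicate k' 2" and b: "b = [c, d]"
    by (cases k) (auto simp: length_conv)
  obtain es q where len: "map length es = replicate k' 2" and
    1: "swap\<^sup>*\<^sup>* (c # d # w # y # concat bs1 @ u # V, d # u # y # c # concat (map rev bs1) @ w # V')
      (concat es @ d # w # q # y # u # V, w # concat (map rev es) @ d # u # y # q # V')"
    using swaps_unnest_aux[OF k(2), of "[]" 0 c d w y u V V'] by auto
  obtain fs where lf: "map length fs = replicate k 2" and
    2: "swap\<^sup>*\<^sup>* (concat es @ d # w # q # y # u # V, w # concat (map rev es) @ d # u # y # q # V')
      (concat fs @ q # y # u # V, concat (map rev fs) @ u # y # q # V')"
    using swaps_rotate_pairs[OF len, of d w "q # y # u # V" "u # y # q # V'"] k by blast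
  have "swap\<^sup>*\<^sup>* (w # y # concat bs @ u # V, u # y # concat (map rev bs) @ w # V')
      (concat fs @ q # y # u # V, concat (map rev fs) @ u # y # q # V')"
    \<comment> \<open>This exchange produces the configuration of \<open>swaps_unnest_aux\<close>
      with no finished 2-block yet.\<close>
    by (rule swap_rtranclpI[where X = "[w]" and s = y and Y = "[c]" and s' = d and
          X' = "[u]" and Y' = "[]"]) (use rtranclp_trans[OF 1 2] Cons b in simp_all)
  with lf show ?thesis by (intro exI[of _ "fs @ [[q, y, u]]"]) auto
qed

text \<open>The two 3-blocks trade their middle letters \<open>y\<close> and \<open>v\<close>. After
  four exchanges \<open>[x, v, z]\<close> is a 3-block directly behind the 2-blocks
  \<open>A\<close>, while \<open>w\<close>, \<open>y\<close>, \<open>u\<close> is a frame around the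
  2-blocks \<open>B\<close>, which \<open>swaps_unnest\<close> straightens.\<close>

lemma conn_exchange_before_three:
  "conn (replicate m 2 @ 3 # T @ 1 # replicate k 2 @ 3 # U)
     (replicate k 2 @ 3 # T @ 1 # replicate m 2 @ 3 # U)"
proof (rule connI)
  fix bs :: "nat list list"
  assume "map length bs = replicate m 2 @ 3 # T @ 1 # replicate k 2 @ 3 # U"
  then obtain bA x y z bT s bB u v w bU where
    bs: "bs = bA @ [x, y, z] # bT @ [s] # bB @ [u, v, w] # bU"
    and len: "map length bA = replicate m 2" "map length bT = T" "map length bB = replicate k 2"
      "map length bU = U"
    by (auto simp: length_conv)
  define A A' t t' B B' r r' where defs: "A = concat bA" "A' = concat (map rev bA)"
    "t = concat bT" "t' = concat (map rev bT)" "B = concat bB" "B' = concat (map rev bB)"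
    "r = concat bU" "r' = concat (map rev bU)"
  obtain bs' where len': "map length bs' = replicate k 2 @ [3]" and
    *: "swap\<^sup>*\<^sup>* (w # y # B @ u # t @ s # A @ x # v # z # r, u # y # B' @ w # t' @ s # A' @ z # v # x # r')
        (concat bs' @ t @ s # A @ x # v # z # r, concat (map rev bs') @ t' @ s # A' @ z # v # x # r')"
    using swaps_unnest[OF len(3), of w y u "t @ s # A @ x # v # z # r" "t' @ s # A' @ z # v # x # r'"]
    unfolding defs by blast
  have "swap\<^sup>*\<^sup>* (A @ x # y # z # t @ s # B @ u # v # w # r, A' @ z # y # x # t' @ s # B' @ w # v # u # r')
        (concat bs' @ t @ s # A @ x # v # z # r, concat (map rev bs') @ t' @ s # A' @ z # v # x # r')"
    apply (rule swap_rtranclpI[where X = A and s = x and Y = "y # z # t" and s' = s and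
          X' = "A' @ z # [y]" and Y' = t']; simp?)
    apply (rule swap_rtranclpI[where X = "[y]" and s = z and Y = "t @ s # A @ x # B @ u # [v]" and s' = w and
          X' = "t' @ s # A'" and Y' = "y # x # B'"]; simp?)
    apply (rule swap_rtranclpI[where X = "t @ s # A" and s = x and Y = B and s' = u and
          X' = "[y]" and Y' = "B' @ w # t' @ s # A' @ z # [v]"]; simp?)
    apply (rule swap_rtranclpI[where X = "B @ u # t @ s # A @ [x]" and s = v and Y = "[w]" and s' = y and
          X' = "B' @ w # t' @ s # A' @ [z]" and Y' = "[u]"]; simp?)
    by (rule *)
  with len len' show "\<exists>bs'. map length bs' = replicate k 2 @ 3 # T @ 1 # replicate m 2 @ 3 # U \<and>
       swap\<^sup>*\<^sup>* (concat bs, concat (map rev bs)) (concat bs', concat (map rev bs'))"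
    by (intro exI[of _ "bs' @ bT @ [s] # bA @ [x, v, z] # bU"]) (simp add: bs defs)
qed

text \<open>The exchange sequences in the next three proofs were found by computer search.\<close>

lemma conn_four:
  "conn (4 # T @ 1 # R @ 2 # 2 # U) (2 # 2 # T @ 1 # R @ 4 # U)"
proof (rule connI)
  fix bs :: "nat list list"
  assume "map length bs = 4 # T @ 1 # R @ 2 # 2 # U"
  then obtain x0 x1 x2 x3 x4 x5 x6 x7 x8 bT bR bU where
    bs: "bs = [x0, x1, x2, x3] # bT @ [x4] # bR @ [x5, x6] # [x7, x8] # bU"
    and len: "map length bT = T" "map length bR = R" "map length bU = U"
    by (auto simp: length_conv)
  define t t' where t: "t = concat bT" "t' = concat (map rev bT)"
  define r r' where r: "r = concat bR" "r' = concat (map rev bR)"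
  define u u' where u: "u = concat bU" "u' = concat (map rev bU)"
  have "swap\<^sup>*\<^sup>* (x0 # x1 # x2 # x3 # t @ x4 # r @ x5 # x6 # x7 # x8 # u, x3 # x2 # x1 # x0 # t' @ x4 # r' @ x6 # x5 # x8 # x7 # u')
      (x0 # x3 # x2 # x1 # t @ x4 # r @ x5 # x8 # x7 # x6 # u, x3 # x0 # x1 # x2 # t' @ x4 # r' @ x6 # x7 # x8 # x5 # u')"
    apply (rule swap_rtranclpI[where X = "x0 # [x1]" and s = x2 and Y = "x3 # t @ x4 # r @ x5 # [x6]" and s' = x7 and
          X' = "[x3]" and Y' = "x1 # x0 # t' @ x4 # r' @ x6 # x5 # [x8]"]; simp?)
    apply (rule swap_rtranclpI[where X = "x3 # t @ x4 # r @ [x5]" and s = x6 and Y = "x7 # x0 # x1 # [x2]" and s' = x8 and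
          X' = "x1 # x0 # t' @ x4 # r'" and Y' = "[x5]"]; simp?)
    apply (rule swap_rtranclpI[where X = "x7 # [x0]" and s = x1 and Y = "x2 # [x8]" and s' = x3 and
          X' = "x5 # [x8]" and Y' = "x0 # t' @ x4 # r' @ x6 # [x7]"]; simp?)
    apply (rule swap_rtranclpI[where X = "x2 # x8 # [x3]" and s = x7 and Y = "x0 # x1 # t @ x4 # r" and s' = x5 and
          X' = "x0 # t' @ x4 # r' @ [x6]" and Y' = "[x3]"]; simp?)
    apply (rule swap_rtranclpI[where X = "x0 # x1 # t @ x4 # r" and s = x5 and Y = "[]" and s' = x2 and
          X' = "[x3]" and Y' = "x0 # t' @ x4 # r' @ x6 # x7 # x8 # [x1]"]; simp?)
    apply (rule swap_rtranclpI[where X = "x2 # x0 # x1 # t @ x4 # r @ [x5]" and s = x8 and Y = "[]" and s' = x3 and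
          X' = "x0 # t' @ x4 # r' @ x6 # [x7]" and Y' = "x1 # [x2]"]; simp?)
    apply (rule swap_rtranclpI[where X = "[x3]" and s = x2 and Y = "[]" and s' = x0 and
          X' = "[x1]" and Y' = "[x3]"]; simp?)
    done
  with len show "\<exists>bs'. map length bs' = 2 # 2 # T @ 1 # R @ 4 # U \<and>
      swap\<^sup>*\<^sup>* (concat bs, concat (map rev bs)) (concat bs', concat (map rev bs'))"
    by (intro exI[of _ "[x0, x3] # [x2, x1] # bT @ [x4] # bR @ [x5, x8, x7, x6] # bU"]) (simp add: bs t r u)
qed

lemma conn_five_aux:
  "conn (5 # 1 # [2]) (2 # 1 # [5])"
proof (rule connI)
  fix bs :: "nat list list"
  assume "map length bs = 5 # 1 # [2]"
  then obtain x0 x1 x2 x3 x4 x5 x6 x7 where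
    bs: "bs = [x0, x1, x2, x3, x4] # [x5] # [[x6, x7]]"
    by (auto simp: length_conv)
  have "swap\<^sup>*\<^sup>* (x0 # x1 # x2 # x3 # x4 # x5 # x6 # [x7], x4 # x3 # x2 # x1 # x0 # x5 # x7 # [x6])
      (x5 # x3 # x1 # x2 # x7 # x4 # x6 # [x0], x3 # x5 # x1 # x0 # x6 # x4 # x7 # [x2])"
    apply (rule swap_rtranclpI[where X = "x0 # x1 # [x2]" and s = x3 and Y = "x4 # [x5]" and s' = x6 and
          X' = "[x4]" and Y' = "x2 # x1 # x0 # x5 # [x7]"]; simp?)
    apply (rule swap_rtranclpI[where X = "x4 # x5 # [x6]" and s = x0 and Y = "x1 # x2 # [x3]" and s' = x7 and
          X' = "x2 # [x1]" and Y' = "[x5]"]; simp?)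
    apply (rule swap_rtranclpI[where X = "[x1]" and s = x2 and Y = "[]" and s' = x3 and
          X' = "x5 # [x7]" and Y' = "x1 # x0 # x6 # [x4]"]; simp?)
    apply (rule swap_rtranclpI[where X = "x3 # x1 # x2 # [x7]" and s = x4 and Y = "[]" and s' = x5 and
          X' = "x1 # x0 # [x6]" and Y' = "[x3]"]; simp?)
    done
  then show "\<exists>bs'. map length bs' = 2 # 1 # [5] \<and>
      swap\<^sup>*\<^sup>* (concat bs, concat (map rev bs)) (concat bs', concat (map rev bs'))"
    by (intro exI[of _ "[x5, x3] # [x1] # [[x2, x7, x4, x6, x0]]"]) (simp add: bs)
qed

lemma conn_five_prefix:
  "conn (P @ 1 # 5 # 1 # [2]) (P @ 1 # 2 # 1 # [5])"
proof (rule connI)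
  fix bs :: "nat list list"
  assume "map length bs = P @ 1 # 5 # 1 # [2]"
  then obtain x0 x1 x2 x3 x4 x5 x6 x7 x8 bP where
    bs: "bs = bP @ [x0] # [x1, x2, x3, x4, x5] # [x6] # [[x7, x8]]"
    and len: "map length bP = P"
    by (auto simp: length_conv)
  define p p' where p: "p = concat bP" "p' = concat (map rev bP)"
  have "swap\<^sup>*\<^sup>* (p @ x0 # x1 # x2 # x3 # x4 # x5 # x6 # x7 # [x8], p' @ x0 # x5 # x4 # x3 # x2 # x1 # x6 # x8 # [x7])
      (p @ x0 # x1 # x5 # x3 # x4 # x8 # x6 # x7 # [x2], p' @ x0 # x5 # x1 # x3 # x2 # x7 # x6 # x8 # [x4])"
    apply (rule swap_rtranclpI[where X = "p @ x0 # x1 # x2 # x3 # [x4]" and s = x5 and Y = "[x6]" and s' = x7 and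
          X' = "p' @ [x0]" and Y' = "x4 # x3 # x2 # x1 # x6 # [x8]"]; simp?)
    apply (rule swap_rtranclpI[where X = "x6 # x7 # p @ x0 # [x1]" and s = x2 and Y = "x3 # x4 # [x5]" and s' = x8 and
          X' = "x4 # [x3]" and Y' = "x1 # [x6]"]; simp?)
    apply (rule swap_rtranclpI[where X = "[x3]" and s = x4 and Y = "[]" and s' = x5 and
          X' = "x1 # x6 # [x8]" and Y' = "x3 # x2 # x7 # p' @ [x0]"]; simp?)
    apply (rule swap_rtranclpI[where X = "x5 # x3 # x4 # x8 # [x6]" and s = x7 and Y = "p @ [x0]" and s' = x1 and
          X' = "x3 # [x2]" and Y' = "p' @ x0 # [x5]"]; simp?)
    done
  with len show "\<exists>bs'. map length bs' = P @ 1 # 2 # 1 # [5] \<and>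
      swap\<^sup>*\<^sup>* (concat bs, concat (map rev bs)) (concat bs', concat (map rev bs'))"
    by (intro exI[of _ "bP @ [x0] # [x1, x5] # [x3] # [[x4, x8, x6, x7, x2]]"]) (simp add: bs p)
qed

subsection \<open>Cycle lengths and chains\<close>

text \<open>The head is the length of the cycle of \<open>Y\<close> through the first letter after \<open>p_0^{-1}(1)\<close>, the last
  entry that of the cycle through the last letter \<open>p_0^{-1}(n)\<close>, which for bookkeeping counts as a
  final 1-block.\<close>

fun cyc_lens :: "nat list \<Rightarrow> nat list" where
  "cyc_lens [] = [1]"
| "cyc_lens (k # L) = (let c = cyc_lens L in
     if even k then (hd c + k) # tl c else (Suc k div 2) # (hd c + k div 2) # tl c)"

lemma cyc_lens_neq_Nil [simp]: "cyc_lens L \<noteq> []"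
  by (cases L) (auto simp: Let_def)

text \<open>A 1-block prepends the entry 1 and changes no other entry, and this 1 is also the value
  that ends the recursion for \<open>c\<close>. Hence the chains contribute independently.\<close>

lemma cyc_lens_append_1: "cyc_lens (c @ 1 # L) = cyc_lens c @ cyc_lens L"
proof (induction c)
  case Nil
  show ?case by (cases "cyc_lens L") (auto simp: Let_def)
next
  case (Cons k c)
  then show ?case by (auto simp: Let_def)
qed

text \<open>The inverse of splitting into chains. The last chain \<open>d\<close> is kept apart
  because it alone has no 1-block after it.\<close>

definition chained :: "nat list list \<Rightarrow> nat list \<Rightarrow> nat list" where
  "chained cs d = concat (map (\<lambda>c. c @ [1]) cs) @ d"

lemma chained_Nil [simp]: "chained [] d = d"
  and chained_Cons: "chained (c # cs) d = c @ 1 # chained cs d"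
  and chained_append: "chained (cs @ cs') d = chained cs (chained cs' d)"
  by (simp_all add: chained_def)

lemma chained_snoc: "chained (cs @ [c]) d = chained cs c @ 1 # d"
  by (simp add: chained_def)

text \<open>Exposes the first and the last chain at once, with a middle part \<open>T\<close> that
  depends on neither, as needed for moves that alter exactly these two.\<close>

lemma chained_Cons_split: "\<exists>T. \<forall>c d. chained (c # cs) d = c @ T @ 1 # d"
proof (cases cs rule: rev_cases)
  case Nil
  then show ?thesis by (intro exI[of _ "[]"]) (simp add: chained_Cons)
next
  case (snoc cs' c')
  then show ?thesis by (intro exI[of _ "1 # chained cs' c'"]) (simp add: chained_Cons chained_snoc)
qed

lemma cyc_lens_chained: "cyc_lens (chained cs d) = concat (map cyc_lens cs) @ cyc_lens d"
  by (induction cs) (simp_all add: chained_Cons cyc_lens_append_1[unfolded One_nat_def])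

lemma chains_neq_Nil [simp]: "chains L \<noteq> []"
  by (induction L) auto

lemma chained_chains: "chained (butlast (chains L)) (last (chains L)) = L"
proof (induction L)
  case (Cons x L)
  then show ?case by (cases "chains L") (auto simp: chained_Cons split: if_splits)
qed simp

lemma in_chains: "c \<in> set (chains L) \<Longrightarrow> k \<in> set c \<Longrightarrow> k \<in> set L \<and> k \<noteq> 1"
proof (induction L arbitrary: c)
  case (Cons x L)
  from Cons.IH[of "hd (chains L)"] Cons.IH[of c] Cons.prems show ?case
    by (cases "chains L") (auto split: if_splits)
qed auto

lemma conn_chained_mset:
  assumes "mset cs = mset cs'"
  shows "conn (chained cs d) (chained cs' d)"
  using assms
proof (induction cs' arbitrary: cs d rule: rev_induct)
  case (snoc x cs')
  then have "x \<in> set cs" by (metis in_set_conv_decomp set_mset_mset)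
  then obtain as bs where cs: "cs = as @ x # bs" by (meson split_list)
  have 1: "conn (chained cs d) (chained (bs @ as @ [x]) d)"
  proof (cases bs rule: rev_cases)
    case Nil
    then show ?thesis by (simp add: cs)
  next
    case (snoc bs' y)
    \<comment> \<open>A single rotation turns \<open>as @ x # bs\<close> into
      \<open>bs @ as @ [x]\<close>.\<close>
    have "conn (chained as x @ 1 # chained bs' y @ 1 # d) (chained bs' y @ 1 # chained as x @ 1 # d)"
      by (rule conn_rotate)
    then show ?thesis
      by (simp add: cs snoc chained_append chained_Cons chained_def)
  qed
  \<comment> \<open>With \<open>x\<close> in its final place, \<open>x @ 1 # d\<close> acts as the
    last chain for the induction hypothesis.\<close>
  have "conn (chained (bs @ as) (x @ 1 # d)) (chained cs' (x @ 1 # d))"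
    using snoc.prems by (intro snoc.IH) (simp add: cs union_commute)
  then have "conn (chained (bs @ as @ [x]) d) (chained (cs' @ [x]) d)"
    by (simp add: chained_append chained_Cons)
  with 1 show ?case by (rule conn_trans)
qed simp

text \<open>A common target makes the relation symmetric by definition, so in mixed cases it is
  enough to move one of the two arrangements.\<close>

definition joined :: "nat list \<Rightarrow> nat list \<Rightarrow> bool" where
  "joined L L' \<longleftrightarrow> (\<exists>C. conn L C \<and> conn L' C)"

lemma joinedI: "conn L L' \<Longrightarrow> joined L L'"
  unfolding joined_def by (blast intro: conn_refl)

lemma joined_sym: "joined L L' \<Longrightarrow> joined L' L"
  unfolding joined_def by blast

text \<open>The last chain is to be counted here as well: the list P depends only on the multiset of
  all chains, and M alone singles out the last one.\<close>

definition cycle_mset :: "nat list multiset \<Rightarrow> nat multiset" where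
  "cycle_mset A = (\<Sum>c\<in>#A. mset (cyc_lens c))"

lemma cycle_mset_simps [simp]:
  "cycle_mset {#} = {#}" "cycle_mset (add_mset c A) = mset (cyc_lens c) + cycle_mset A"
  "cycle_mset (A + B) = cycle_mset A + cycle_mset B"
  by (simp_all add: cycle_mset_def)

lemma mset_cyc_lens_chained: "mset (cyc_lens (chained cs d)) = cycle_mset (mset cs + {#d#})"
  by (induction cs) (simp_all add: cyc_lens_chained)

lemma last_cyc_lens_chained: "last (cyc_lens (chained cs d)) = last (cyc_lens d)"
  by (simp add: cyc_lens_chained)

section \<open>Cycle lengths of the chains that occur in the types\<close>

lemma cyc_lens_twos_append:
  "cyc_lens (replicate m 2 @ L) = (hd (cyc_lens L) + 2 * m) # tl (cyc_lens L)"
  by (induction m) (auto simp: Let_def)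

abbreviation twos :: "nat \<Rightarrow> nat list" where
  "twos m \<equiv> replicate m 2"

definition three :: "nat \<times> nat \<Rightarrow> nat list" where
  "three p = twos (fst p) @ 3 # twos (snd p)"

lemma cyc_lens_twos [simp]: "cyc_lens (twos m) = [2 * m + 1]"
  using cyc_lens_twos_append[of m "[]"] by simp

lemma cyc_lens_three [simp]: "cyc_lens (three p) = [2 * fst p + 2, 2 * snd p + 2]"
  unfolding three_def cyc_lens_twos_append by (simp add: Let_def)

lemma cyc_lens_four [simp]: "cyc_lens (4 # twos m) = [2 * m + 5]"
  by (simp add: Let_def)

lemma cyc_lens_five [simp]: "cyc_lens [5] = [3, 3]"
  by (simp add: Let_def)

subsection \<open>One nontrivial block\<close>

text \<open>An even \<open>k\<close> gives the single entry k + 1, an odd \<open>k\<close> two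
  entries, both (k + 1) / 2; so the number of entries reveals the parity.\<close>

lemma cyc_lens_single_inj:
  assumes "mset (cyc_lens [k]) = mset (cyc_lens [k'])"
  shows "k = k'"
  using assms by (auto simp: Let_def add_eq_conv_ex split: if_splits elim!: evenE oddE)

text \<open>Consequently the entries 1 count the empty chains.\<close>

lemma cyc_lens_single_ge:
  assumes "2 \<le> k" "x \<in> set (cyc_lens [k])"
  shows "x \<noteq> 1"
  using assms by (auto simp: Let_def split: if_splits elim!: oddE)

lemma joined_type1:
  assumes chain: "\<And>c. c \<in># mset cs + {#d#} \<Longrightarrow> c \<noteq> [] \<Longrightarrow> \<exists>k\<ge>2. c = [k]"
      "\<And>c. c \<in># mset cs' + {#d'#} \<Longrightarrow> c \<noteq> [] \<Longrightarrow> \<exists>k\<ge>2. c = [k]"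
    and size: "size (filter_mset (\<lambda>c. c \<noteq> []) (mset cs + {#d#})) \<le> 1"
      "size (filter_mset (\<lambda>c. c \<noteq> []) (mset cs' + {#d'#})) \<le> 1"
    and P: "cycle_mset (mset cs + {#d#}) = cycle_mset (mset cs' + {#d'#})"
    and M: "last (cyc_lens d) = last (cyc_lens d')"
  shows "joined (chained cs d) (chained cs' d')"
proof -
  have form: "\<exists>r B. A = replicate_mset r [] + B \<and> (B = {#} \<or> (\<exists>k\<ge>2. B = {#[k]#})) \<and>
      filter_mset (\<lambda>x. x \<noteq> 1) (cycle_mset A) = cycle_mset B \<and> cycle_mset A = replicate_mset r 1 + cycle_mset B"
    if A1: "\<And>c. c \<in># A \<Longrightarrow> c \<noteq> [] \<Longrightarrow> \<exists>k\<ge>2. c = [k]"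
      and A2: "size (filter_mset (\<lambda>c. c \<noteq> []) A) \<le> 1" for A
  proof -
    define B where "B = filter_mset (\<lambda>c. c \<noteq> []) A"
    define r where "r = count A []"
    have A: "A = replicate_mset r [] + B"
      by (rule multiset_eqI) (simp add: B_def r_def)
    have B: "B = {#} \<or> (\<exists>k\<ge>2. B = {#[k]#})"
    proof (cases "B = {#}")
      case False
      then obtain c where "B = {#c#}"
        using A2 unfolding B_def[symmetric]
        by (metis One_nat_def le_SucE le_zero_eq size_1_singleton_mset size_eq_0_iff_empty)
      then have "c \<in># filter_mset (\<lambda>c. c \<noteq> []) A" unfolding B_def by simp
      with \<open>B = {#c#}\<close> show ?thesis using A1[of c] by auto
    qed simp
    have cr: "cycle_mset (replicate_mset r []) = replicate_mset r 1" for r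
      by (induction r) simp_all
    have "filter_mset (\<lambda>x. x \<noteq> 1) (cycle_mset B) = cycle_mset B"
      using B by (auto simp: filter_mset_eq_conv simp del: cyc_lens.simps dest: cyc_lens_single_ge)
    moreover have "filter_mset (\<lambda>x. x \<noteq> 1) (replicate_mset r (1::nat)) = {#}"
      by (auto simp: filter_mset_eq_conv)
    ultimately show ?thesis using A B cr by (metis add_0 cycle_mset_simps(3) filter_union_mset)
  qed
  obtain r B where A: "mset cs + {#d#} = replicate_mset r [] + B" and B: "B = {#} \<or> (\<exists>k\<ge>2. B = {#[k]#})"
    and fB: "filter_mset (\<lambda>x. x \<noteq> 1) (cycle_mset (mset cs + {#d#})) = cycle_mset B"
      "cycle_mset (mset cs + {#d#}) = replicate_mset r 1 + cycle_mset B"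
    using form[OF chain(1) size(1)] by blast
  obtain r' B' where A': "mset cs' + {#d'#} = replicate_mset r' [] + B'" and B': "B' = {#} \<or> (\<exists>k\<ge>2. B' = {#[k]#})"
    and fB': "filter_mset (\<lambda>x. x \<noteq> 1) (cycle_mset (mset cs' + {#d'#})) = cycle_mset B'"
      "cycle_mset (mset cs' + {#d'#}) = replicate_mset r' 1 + cycle_mset B'"
    using form[OF chain(2) size(2)] by blast
  have BB: "cycle_mset B = cycle_mset B'" using fB fB' P by metis
  then have "B = B'"
    using B B' cyc_lens_single_inj by (auto simp del: cyc_lens.simps)
  moreover have "r = r'"
    using fB(2) fB'(2) P BB by (metis add_right_cancel size_replicate_mset)
  ultimately have eq: "mset cs + {#d#} = mset cs' + {#d'#}" using A A' by simp
  have "d = d'"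
  proof -
    have "d \<in># replicate_mset r [] + B" "d' \<in># replicate_mset r [] + B"
      using A eq by (metis multi_member_last union_iff)+
    \<comment> \<open>Both last chains come from one multiset with at most one nonempty member, so
      if they differ, exactly one of them is empty. Then exactly one of the two last cycle lengths
      is 1, which M excludes.\<close>
    then have "d = d' \<or> (\<exists>k\<ge>2. {d, d'} = {[], [k]})"
      using B by (auto simp: in_replicate_mset split: if_splits)
    moreover have "last (cyc_lens [k]) \<noteq> last (cyc_lens [])" if "2 \<le> k" for k
      using cyc_lens_single_ge[OF that, of "last (cyc_lens [k])"] by (simp del: cyc_lens.simps(2))
    ultimately show ?thesis using M by (metis doubleton_eq_iff)
  qed
  with eq have "mset cs = mset cs'" by simp
  with \<open>d = d'\<close> show ?thesis by (auto intro: joinedI conn_chained_mset)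
qed

subsection \<open>Chains of 2-blocks\<close>

definition all_twos :: "nat list multiset \<Rightarrow> bool" where
  "all_twos A \<longleftrightarrow> (\<forall>c\<in>#A. \<exists>m. c = twos m)"

text \<open>A chain of m 2-blocks contributes the one entry 2m + 1, and halving recovers m; m = 0
  covers empty chains.\<close>

lemma cycle_mset_twos:
  assumes "all_twos A"
  shows "A = image_mset (\<lambda>x. twos (x div 2)) (cycle_mset A)"
  using assms by (induction A) (auto simp: all_twos_def)

lemma all_twos_add: "all_twos A \<Longrightarrow> all_twos (add_mset (twos m) A)"
  by (auto simp: all_twos_def)

lemma all_twos_eq: "all_twos A \<Longrightarrow> all_twos B \<Longrightarrow> cycle_mset A = cycle_mset B \<Longrightarrow> A = B"
  using cycle_mset_twos by metis

lemma joined_type2: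
  assumes "all_twos (mset cs + {#d#})" "all_twos (mset cs' + {#d'#})"
    and "cycle_mset (mset cs + {#d#}) = cycle_mset (mset cs' + {#d'#})"
    and "last (cyc_lens d) = last (cyc_lens d')"
  shows "joined (chained cs d) (chained cs' d')"
proof -
  from assms have "d = d'" by (auto simp: all_twos_def)
  moreover from all_twos_eq[OF assms(1-3)] this have "mset cs = mset cs'" by simp
  ultimately show ?thesis by (auto intro: joinedI conn_chained_mset)
qed

subsection \<open>Chains with a 3-block\<close>

text \<open>This is what P retains of the chains with a 3-block: the counts of 2-blocks on either
  side, without sides and without the pairing.\<close>

definition flat :: "(nat \<times> nat) list \<Rightarrow> nat multiset" where
  "flat ps = mset (map fst ps) + mset (map snd ps)"

lemma flat_simps [simp]: "flat [] = {#}" "flat (p # ps) = {#fst p, snd p#} + flat ps"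
  "flat (ps @ ps') = flat ps + flat ps'"
  by (simp_all add: flat_def)

lemma conn_three_mset:
  assumes "mset ps = mset ps'"
  shows "conn (chained (map three ps) D) (chained (map three ps') D)"
  using assms by (intro conn_chained_mset) simp

lemma conn_three_flip:
  "conn (chained (map three ((a, b) # ps)) D) (chained (map three ((b, a) # ps)) D)"
  using conn_reverse[of "three (a, b)" "chained (map three ps) D"]
  by (simp add: three_def chained_Cons)

lemma conn_three_exchange:
  "conn (chained (map three ((a, b) # (c, d) # ps)) D) (chained (map three ((c, b) # (a, d) # ps)) D)"
  using conn_exchange_before_three[of a "twos b" c "twos d @ 1 # chained (map three ps) D"]
  by (simp add: three_def chained_Cons)

lemma conn_three_to_front:
  assumes "a \<in># flat ps"
  shows "\<exists>b ps'. flat ps = {#a, b#} + flat ps' \<and>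
    (\<forall>D. conn (chained (map three ps) D) (chained (map three ((a, b) # ps')) D))"
proof -
  from assms obtain p where p: "p \<in> set ps" "a = fst p \<or> a = snd p"
    by (auto simp: flat_def)
  then obtain us vs where ps: "ps = us @ p # vs" by (meson split_list)
  have 1: "conn (chained (map three ps) D) (chained (map three (p # us @ vs)) D)" for D
    by (rule conn_three_mset) (simp add: ps)
  show ?thesis
  proof (cases "a = fst p")
    case True
    with 1 show ?thesis by (intro exI[of _ "snd p"] exI[of _ "us @ vs"]) (simp add: ps)
  next
    case False
    have "conn (chained (map three ps) D) (chained (map three ((snd p, fst p) # us @ vs)) D)" for D
      using conn_trans[OF 1 conn_three_flip[of "fst p" "snd p" "us @ vs" D, unfolded prod.collapse]] .
    with p False show ?thesis by (intro exI[of _ "fst p"] exI[of _ "us @ vs"]) (simp add: ps)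
  qed
qed

text \<open>Any two counts can be made neighbours of the same 3-block. The finished chain is put
  last, where it can be absorbed into \<open>D\<close> while the others are treated.\<close>

lemma conn_three_pair_last:
  assumes "flat ps = {#a, b#} + F"
  shows "\<exists>rs. flat rs = F \<and>
    (\<forall>D. conn (chained (map three ps) D) (chained (map three (rs @ [(a, b)])) D))"
proof -
  obtain y ps1 where 1: "flat ps = {#a, y#} + flat ps1"
    "\<And>D. conn (chained (map three ps) D) (chained (map three ((a, y) # ps1)) D)"
    using conn_three_to_front[of a ps] assms by auto
  show ?thesis
  proof (cases "y = b")
    case True
    have "conn (chained (map three ps) D) (chained (map three (ps1 @ [(a, b)])) D)" for D
      using 1(2)[unfolded True] by (rule conn_trans) (rule conn_three_mset, simp)
    with 1 True assms show ?thesis by (intro exI[of _ ps1]) auto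
  next
    case False
    with 1(1) assms have "b \<in># flat ps1" by (auto simp: add_eq_conv_ex)
    then obtain z ps2 where 2: "flat ps1 = {#b, z#} + flat ps2"
      "\<And>D. conn (chained (map three ps1) D) (chained (map three ((b, z) # ps2)) D)"
      using conn_three_to_front[of b ps1] by auto
    have "conn (chained (map three ps) D) (chained (map three (((y, z) # ps2) @ [(a, b)])) D)" for D
    proof -
      note 1(2)
      also have "conn (chained (map three ((a, y) # ps1)) D) (chained (map three (ps1 @ [(a, y)])) D)"
        by (rule conn_three_mset) simp
      also have "conn (chained (map three (ps1 @ [(a, y)])) D)
          (chained (map three (((b, z) # ps2) @ [(a, y)])) D)"
        unfolding map_append chained_append by (rule 2(2))
      also have "conn (chained (map three (((b, z) # ps2) @ [(a, y)])) D)
          (chained (map three ((a, y) # (b, z) # ps2)) D)"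
        by (rule conn_three_mset) simp
      \<comment> \<open>From (a, y), (b, z) via (y, a), (b, z) and (b, a), (y, z) to (a, b), (y,
        z).\<close>
      also note conn_three_flip
      also note conn_three_exchange
      also note conn_three_flip
      also have "conn (chained (map three ((a, b) # (y, z) # ps2)) D)
          (chained (map three (((y, z) # ps2) @ [(a, b)])) D)"
        by (rule conn_three_mset) simp
      finally show ?thesis .
    qed
    with 1(1) 2(1) assms show ?thesis by (intro exI[of _ "(y, z) # ps2"]) auto
  qed
qed

lemma conn_three_flat:
  assumes "flat ps = flat ps'"
  shows "conn (chained (map three ps) D) (chained (map three ps') D)"
  using assms
proof (induction ps' arbitrary: ps D)
  case Nil
  then show ?case by (cases ps) auto
next
  case (Cons p ps')
  obtain rs where 1: "flat rs = flat ps'"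
    "\<And>D. conn (chained (map three ps) D) (chained (map three (rs @ [p])) D)"
    using conn_three_pair_last[of ps "fst p" "snd p" "flat ps'"] Cons.prems by auto
  have "conn (chained (map three (rs @ [p])) D) (chained (map three (ps' @ [p])) D)"
    unfolding map_append chained_append by (rule Cons.IH[OF 1(1)])
  also have "conn (chained (map three (ps' @ [p])) D) (chained (map three (p # ps')) D)"
    by (rule conn_three_mset) simp
  finally show ?case using 1(2) conn_trans by blast
qed

lemma cycle_mset_three: "cycle_mset (mset (map three ps)) = image_mset (\<lambda>x. 2 * x + 2) (flat ps)"
  by (induction ps) auto

lemma conn_three_twos:
  assumes "mset cs = mset (map three ps) + A" "mset cs' = mset (map three ps') + A"
    and "flat ps = flat ps'"
  shows "conn (chained cs d) (chained cs' d)"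
proof -
  obtain ts where ts: "mset ts = A" by (meson ex_mset)
  have "conn (chained cs d) (chained (map three ps @ ts) d)"
    using assms ts by (intro conn_chained_mset) simp
  also have "conn (chained (map three ps @ ts) d) (chained (map three ps' @ ts) d)"
    unfolding chained_append by (rule conn_three_flat[OF assms(3)])
  also have "conn (chained (map three ps' @ ts) d) (chained cs' d)"
    using assms ts by (intro conn_chained_mset) simp
  finally show ?thesis .
qed

lemma split_threes:
  assumes "\<forall>c\<in>set cs. (\<exists>p. c = three p) \<or> (\<exists>m. c = twos m)"
  shows "\<exists>ps A. mset cs = mset (map three ps) + A \<and> all_twos A"
  using assms
proof (induction cs)
  case Nil
  show ?case by (intro exI[of _ "[]"]) (auto simp: all_twos_def)
next
  case (Cons c cs)
  then obtain ps A where IH: "mset cs = mset (map three ps) + A" "all_twos A" by auto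
  from Cons.prems consider p where "c = three p" | m where "c = twos m" by auto
  then show ?case
  proof cases
    case 1
    with IH show ?thesis by (intro exI[of _ "p # ps"] exI[of _ A]) auto
  next
    case 2
    with IH show ?thesis by (intro exI[of _ ps] exI[of _ "add_mset c A"]) (auto simp: all_twos_def)
  qed
qed

text \<open>A chain with a 3-block yields only even cycle lengths, a chain of 2-blocks only odd
  ones, so filtering by parity separates the two kinds.\<close>

lemma cycle_mset_parity_split:
  assumes "image_mset (\<lambda>x. 2 * x + 2) F + cycle_mset A = image_mset (\<lambda>x. 2 * x + 2) F' + cycle_mset A'"
    and "all_twos A" "all_twos A'"
  shows "F = F' \<and> A = A'"
proof -
  have even: "filter_mset even (cycle_mset A) = {#}" if "all_twos A" for A
    using that by (induction A) (auto simp: all_twos_def)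
  have odd: "filter_mset even (image_mset (\<lambda>x. 2 * x + 2) F) = image_mset (\<lambda>x. 2 * x + 2) F"
    for F :: "nat multiset"
    by (induction F) auto
  have inj: "inj (\<lambda>x::nat. 2 * x + 2)" by (auto simp: inj_def)
  have "image_mset (\<lambda>x. 2 * x + 2) F = image_mset (\<lambda>x. 2 * x + 2) F'"
    using arg_cong[OF assms(1), of "filter_mset even"] assms(2,3) by (simp only: filter_union_mset even odd) simp
  then have F: "F = F'" using inj by (metis injD multiset.inj_map)
  with assms(1) have "cycle_mset A = cycle_mset A'" by simp
  with F show ?thesis using all_twos_eq assms(2,3) by blast
qed

lemma joined_type3:
  assumes chain: "\<forall>c\<in>set (cs @ [d]). (\<exists>p. c = three p) \<or> (\<exists>m. c = twos m)"
      "\<forall>c\<in>set (cs' @ [d']). (\<exists>p. c = three p) \<or> (\<exists>m. c = twos m)"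
    and P: "cycle_mset (mset cs + {#d#}) = cycle_mset (mset cs' + {#d'#})"
    and M: "last (cyc_lens d) = last (cyc_lens d')"
  shows "joined (chained cs d) (chained cs' d')"
proof -
  obtain ps A where A: "mset cs = mset (map three ps) + A" "all_twos A"
    using split_threes[of cs] chain by auto
  obtain ps' A' where A': "mset cs' = mset (map three ps') + A'" "all_twos A'"
    using split_threes[of cs'] chain by auto
  have P': "image_mset (\<lambda>x. 2 * x + 2) (flat ps) + cycle_mset A + mset (cyc_lens d) =
      image_mset (\<lambda>x. 2 * x + 2) (flat ps') + cycle_mset A' + mset (cyc_lens d')"
    using P unfolding A A' by (simp add: cycle_mset_three ac_simps del: mset_map)
  have "(\<exists>p. d = three p) \<or> (\<exists>m. d = twos m)" "(\<exists>p. d' = three p) \<or> (\<exists>m. d' = twos m)"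
    using chain by auto
  \<comment> \<open>An odd last cycle length means a chain of 2-blocks and fixes their number; an
    even one fixes the 2-blocks behind the 3-block but not those before it.\<close>
  then consider n where "d = twos n" "d' = twos n"
    | a a' l where "d = three (a, l)" "d' = three (a', l)"
    using M by auto presburger+
  then show ?thesis
  proof cases
    case 1
    with P' cycle_mset_parity_split[OF _ A(2) A'(2), of "flat ps" "flat ps'"] A A' 
    show ?thesis by (auto intro!: joinedI conn_three_twos[of _ ps A _ ps'])
  next
    case 2
    have "image_mset (\<lambda>x. 2 * x + 2) (flat ps + {#a#}) + cycle_mset A =
      image_mset (\<lambda>x. 2 * x + 2) (flat ps' + {#a'#}) + cycle_mset A'"
      using P' 2 by simp
    from cycle_mset_parity_split[OF this A(2) A'(2)]
    have F: "flat ps + {#a#} = flat ps' + {#a'#}" and AA: "A = A'" by auto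
    show ?thesis
    proof (cases "a = a'")
      case True
      with F A A' 2 AA show ?thesis by (auto intro!: joinedI conn_three_twos[of _ ps A _ ps'])
    next
      case False
      \<comment> \<open>The count \<open>a'\<close> wanted in the last chain must occur in some
        earlier chain, which is brought to the front with \<open>a'\<close> before its
        3-block.\<close>
      with F have "a' \<in># flat ps" by (auto simp: add_eq_conv_ex)
      then obtain b qs where qs: "flat ps = {#a', b#} + flat qs" using conn_three_to_front by blast
      obtain ts where ts: "mset ts = A" by (meson ex_mset)
      obtain T where T: "\<And>c d. chained (c # map three qs @ ts) d = c @ T @ 1 # d"
        using chained_Cons_split by blast
      have "conn (chained cs d) (chained (map three ((a', b) # qs) @ ts) d)"
        using A ts qs by (intro conn_three_twos[of _ ps A _ "(a', b) # qs"]) auto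
      \<comment> \<open>The first and the last chain trade the 2-blocks before their
        3-blocks.\<close>
      also have "conn (chained (map three ((a', b) # qs) @ ts) d) (chained (map three ((a, b) # qs) @ ts) d')"
        using conn_exchange_before_three[of a' "twos b @ T" a "twos l"]
        by (simp add: 2 T) (simp add: three_def)
      also have "conn (chained (map three ((a, b) # qs) @ ts) d') (chained cs' d')"
        using A' AA ts qs F
        by (intro conn_three_twos[of _ "(a, b) # qs" A _ ps']) (auto simp: add_mset_commute)
      finally show ?thesis by (rule joinedI)
    qed
  qed
qed

subsection \<open>Chains with a 4-block\<close>

lemma joined_type4:
  assumes "(\<exists>m A. mset cs = add_mset (4 # twos m) A \<and> all_twos (add_mset d A)) \<or>
      (\<exists>m. d = 4 # twos m \<and> all_twos (mset cs))"
    and "(\<exists>m A. mset cs' = add_mset (4 # twos m) A \<and> all_twos (add_mset d' A)) \<or>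
      (\<exists>m. d' = 4 # twos m \<and> all_twos (mset cs'))"
    and "cycle_mset (mset cs + {#d#}) = cycle_mset (mset cs' + {#d'#})"
    and "last (cyc_lens d) = last (cyc_lens d')"
  shows "joined (chained cs d) (chained cs' d')"
proof -
  have mixed: "joined (chained cs d) (chained cs' d')"
    if A: "mset cs = add_mset (4 # twos m) A" "all_twos (add_mset d A)"
      and A': "d' = 4 # twos m'" "all_twos (mset cs')"
      and P: "cycle_mset (mset cs + {#d#}) = cycle_mset (mset cs' + {#d'#})"
      and M: "last (cyc_lens d) = last (cyc_lens d')" for cs cs' d d' m m' A
  proof -
    from A obtain n where "d = twos n" by (auto simp: all_twos_def)
    moreover from this A' M have "n = Suc (Suc m')" by (simp del: cyc_lens.simps)
    ultimately have d: "d = 2 # 2 # twos m'" by simp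
    obtain ts where ts: "mset ts = A" by (meson ex_mset)
    obtain T where T: "\<And>c d. chained (c # ts) d = c @ T @ 1 # d"
      using chained_Cons_split by blast
    \<comment> \<open>Both \<open>4 # twos m\<close> and \<open>twos (m + 2)\<close> have the one
      cycle length 2m + 5, so the 4-block may be read as two 2-blocks and \<open>all_twos_eq\<close>
      applies.\<close>
    have "cycle_mset (add_mset (twos (m + 2)) A) = cycle_mset (mset cs')"
      using P A A' d by (simp add: Let_def flip: numeral_2_eq_2) (simp_all add: numeral_eq_Suc)
    then have eq: "add_mset (twos (m + 2)) A = mset cs'"
      using A A' by (intro all_twos_eq all_twos_add) (auto simp: all_twos_def)
    have "conn (chained cs d) (chained ((4 # twos m) # ts) d)"
      using A ts by (intro conn_chained_mset) simp
    also have "conn (chained ((4 # twos m) # ts) d) (chained (twos (m + 2) # ts) d')"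
      using conn_four[of "twos m @ T" "[]" "twos m'"] by (simp add: T d A')
    also have "conn (chained (twos (m + 2) # ts) d') (chained cs' d')"
      using eq ts by (intro conn_chained_mset) simp
    finally show ?thesis by (rule joinedI)
  qed
  from assms(1,2) consider
      m A m' A' where "mset cs = add_mset (4 # twos m) A" "all_twos (add_mset d A)"
        "mset cs' = add_mset (4 # twos m') A'" "all_twos (add_mset d' A')"
    | m A m' where "mset cs = add_mset (4 # twos m) A" "all_twos (add_mset d A)"
        "d' = 4 # twos m'" "all_twos (mset cs')"
    | m m' A' where "d = 4 # twos m" "all_twos (mset cs)"
        "mset cs' = add_mset (4 # twos m') A'" "all_twos (add_mset d' A')"
    | m m' where "d = 4 # twos m" "all_twos (mset cs)" "d' = 4 # twos m'" "all_twos (mset cs')"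
    by blast
  then show ?thesis
  proof cases
    case 1
    then have d: "d = d'" using assms(4) by (auto simp: all_twos_def)
    show ?thesis
    proof (cases "m = m'")
      case True
      with 1 d assms(3) have "A = A'" by (intro all_twos_eq) (auto simp: all_twos_def)
      with 1 True d show ?thesis by (auto intro!: joinedI conn_chained_mset)
    next
      case False
      have "cycle_mset (add_mset (twos (m + 2)) A) = cycle_mset (add_mset (twos (m' + 2)) A')"
        using 1 d assms(3) by (simp add: Let_def) (simp add: numeral_eq_Suc)
      then have eq: "add_mset (twos (m + 2)) A = add_mset (twos (m' + 2)) A'"
        using 1 by (intro all_twos_eq all_twos_add) (auto simp: all_twos_def)
      \<comment> \<open>For different m and m', the chain that carries the 4-block on one side is a
        chain of 2-blocks on the other; \<open>conn_four\<close> interchanges these roles.\<close>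
      with False obtain C where C: "A = add_mset (twos (m' + 2)) C" "A' = add_mset (twos (m + 2)) C"
        by (auto simp: add_eq_conv_ex)
      obtain ts where ts: "mset ts = C" by (meson ex_mset)
      have "conn (chained cs d) (chained ((4 # twos m) # twos (m' + 2) # ts) d)"
        using 1 C ts by (intro conn_chained_mset) simp
      also have "conn (chained ((4 # twos m) # twos (m' + 2) # ts) d)
          (chained (twos (m + 2) # (4 # twos m') # ts) d)"
        using conn_four[of "twos m" "[]" "twos m' @ 1 # chained ts d"] by (simp add: chained_Cons)
      also have "conn (chained (twos (m + 2) # (4 # twos m') # ts) d) (chained cs' d)"
        using 1 C ts by (intro conn_chained_mset) simp
      finally show ?thesis unfolding d by (rule joinedI)
    qed
  next
    case 2
    from mixed[OF this assms(3,4)] show ?thesis .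
  next
    case 3
    from joined_sym[OF mixed[OF 3(3,4,1,2) assms(3,4)[symmetric]]] show ?thesis .
  next
    case 4
    then have "d = d'" using assms(4) by simp
    moreover with 4 assms(3) have "mset cs = mset cs'" by (intro all_twos_eq) auto
    ultimately show ?thesis by (auto intro: joinedI conn_chained_mset)
  qed
qed

subsection \<open>Chains with a 5-block\<close>

text \<open>If there are further chains, the 5-block first moves to the place next to the last
  chain, where the exchange is local.\<close>

lemma conn_five_last:
  "conn (chained ([5] # cs) [2]) (chained ([2] # cs) [5])"
proof (cases cs rule: rev_cases)
  case Nil
  then show ?thesis using conn_five_aux by (simp add: chained_Cons)
next
  case (snoc cs' c)
  have "conn (chained ([5] # cs) [2]) (chained (cs @ [[5]]) [2])"
    by (rule conn_chained_mset) simp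
  also have "conn (chained (cs @ [[5]]) [2]) (chained (cs @ [[2]]) [5])"
    using conn_five_prefix[of "chained cs' c"] by (simp add: snoc chained_append chained_Cons chained_def)
  also have "conn (chained (cs @ [[2]]) [5]) (chained ([2] # cs) [5])"
    by (rule conn_chained_mset) simp
  finally show ?thesis .
qed

lemma joined_type5:
  assumes "(\<exists>A. mset cs = add_mset [5] A \<and> all_twos (add_mset d A)) \<or> d = [5] \<and> all_twos (mset cs)"
    and "(\<exists>A. mset cs' = add_mset [5] A \<and> all_twos (add_mset d' A)) \<or> d' = [5] \<and> all_twos (mset cs')"
    and "cycle_mset (mset cs + {#d#}) = cycle_mset (mset cs' + {#d'#})"
    and "last (cyc_lens d) = last (cyc_lens d')"
  shows "joined (chained cs d) (chained cs' d')"
proof -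
  have mixed: "joined (chained cs d) (chained cs' d')"
    if A: "mset cs = add_mset [5] A" "all_twos (add_mset d A)" and A': "d' = [5]" "all_twos (mset cs')"
      and P: "cycle_mset (mset cs + {#d#}) = cycle_mset (mset cs' + {#d'#})"
      and M: "last (cyc_lens d) = last (cyc_lens d')" for cs cs' d d' A
  proof -
    from A obtain m where "d = twos m" by (auto simp: all_twos_def)
    \<comment> \<open>The last cycle length of \<open>[5]\<close> is 3, and 2m + 1 = 3 forces m =
      1.\<close>
    with M A' have d: "d = [2]" by (simp del: cyc_lens.simps)
    obtain ts where ts: "mset ts = A" by (meson ex_mset)
    have "cycle_mset (add_mset [2] A) = cycle_mset (mset cs')"
      using P A A' d by (simp add: Let_def)
    then have eq: "add_mset [2] A = mset cs'"
      using A A' d by (intro all_twos_eq) (auto simp: all_twos_def)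
    have "conn (chained cs d) (chained ([5] # ts) d)"
      using A ts by (intro conn_chained_mset) simp
    also have "conn (chained ([5] # ts) d) (chained ([2] # ts) d')"
      unfolding d A' by (rule conn_five_last)
    also have "conn (chained ([2] # ts) d') (chained cs' d')"
      using eq ts by (intro conn_chained_mset) simp
    finally show ?thesis by (rule joinedI)
  qed
  from assms(1,2) consider
      A A' where "mset cs = add_mset [5] A" "all_twos (add_mset d A)"
        "mset cs' = add_mset [5] A'" "all_twos (add_mset d' A')"
    | A where "mset cs = add_mset [5] A" "all_twos (add_mset d A)" "d' = [5]" "all_twos (mset cs')"
    | A' where "d = [5]" "all_twos (mset cs)" "mset cs' = add_mset [5] A'" "all_twos (add_mset d' A')"
    | "d = [5]" "all_twos (mset cs)" "d' = [5]" "all_twos (mset cs')"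
    by blast
  then show ?thesis
  proof cases
    case 1
    then have "d = d'" using assms(4) by (auto simp: all_twos_def)
    moreover with 1 assms(3) have "A = A'" by (intro all_twos_eq) (auto simp: all_twos_def)
    ultimately show ?thesis using 1 by (auto intro!: joinedI conn_chained_mset)
  next
    case 2
    from mixed[OF this assms(3,4)] show ?thesis .
  next
    case 3
    from joined_sym[OF mixed[OF 3(3,4,1,2) assms(3,4)[symmetric]]] show ?thesis .
  next
    case 4
    with assms(3) have "mset cs = mset cs'" by (intro all_twos_eq) auto
    with 4 show ?thesis by (auto intro: joinedI conn_chained_mset)
  qed
qed

subsection \<open>All types\<close>

text \<open>Types 4 and 5 mark one chain by its index; afterwards it only matters whether this is
  the last chain.\<close>

lemma split_special_chain:
  assumes xs: "xs = cs @ [d]" and i: "i < length xs" "P (xs ! i)"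
    and twos: "\<And>j. j < length xs \<Longrightarrow> j \<noteq> i \<Longrightarrow> \<exists>m. xs ! j = twos m"
  shows "(\<exists>c A. P c \<and> mset cs = add_mset c A \<and> all_twos (add_mset d A)) \<or> P d \<and> all_twos (mset cs)"
proof (cases "i = length cs")
  case True
  have "\<exists>m. cs ! j = twos m" if "j < length cs" for j
    using twos[of j] xs that True by (simp add: nth_append)
  then have "all_twos (mset cs)" by (auto simp: all_twos_def in_set_conv_nth)
  with True i xs show ?thesis by simp
next
  case False
  then have il: "i < length cs" using i xs by simp
  define us vs where "us = take i cs" "vs = drop (Suc i) cs"
  have cs: "cs = us @ cs ! i # vs" unfolding us_vs_def by (rule id_take_nth_drop[OF il])
  have *: "\<exists>m. cs ! j = twos m" if "j < length cs" "j \<noteq> i" for j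
    using twos[of j] xs that by (simp add: nth_append)
  have "\<exists>m. c = twos m" if "c \<in> set us \<or> c \<in> set vs" for c
    using that
  proof
    assume "c \<in> set us"
    then obtain j where "j < length us" "c = us ! j" by (metis in_set_conv_nth)
    with *[of j] il show ?thesis by (simp add: us_vs_def)
  next
    assume "c \<in> set vs"
    then obtain j where "j < length vs" "c = vs ! j" by (metis in_set_conv_nth)
    with *[of "Suc i + j"] il show ?thesis by (simp add: us_vs_def)
  qed
  moreover have "\<exists>m. d = twos m" using twos[of "length cs"] xs False by simp
  ultimately have "all_twos (add_mset d (mset us + mset vs))" by (auto simp: all_twos_def)
  moreover have "mset cs = add_mset (cs ! i) (mset us + mset vs)" by (subst cs) simp
  moreover have "P (cs ! i)" using i il xs by (simp add: nth_append)
  ultimately show ?thesis by blast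
qed

lemma all_2_twos: "\<forall>s\<in>set c. s = 2 \<Longrightarrow> \<exists>m. c = twos m"
  by (metis replicate_length_same)

lemma type_of_sizes_simps:
  "type_of_sizes 1 L \<longleftrightarrow> length (filter (\<lambda>c. c \<noteq> []) (chains L)) \<le> 1 \<and>
     (\<forall>c\<in>set (chains L). c \<noteq> [] \<longrightarrow> length c = 1)"
  "type_of_sizes 2 L \<Longrightarrow> \<forall>c\<in>set (chains L). \<forall>s\<in>set c. s = 2"
  "type_of_sizes 3 L \<Longrightarrow> \<forall>c\<in>set (chains L). c \<noteq> [] \<longrightarrow>
     (\<exists>m l. c = replicate m 2 @ [3] @ replicate l 2) \<or> (\<exists>m\<ge>1. c = replicate m 2)"
  "type_of_sizes 4 L \<Longrightarrow> \<exists>i<length (chains L). (\<exists>m. chains L ! i = 4 # replicate m 2) \<and>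
     (\<forall>j<length (chains L). j \<noteq> i \<longrightarrow> (\<forall>s\<in>set (chains L ! j). s = 2))"
  "type_of_sizes 5 L \<Longrightarrow> \<exists>i<length (chains L). chains L ! i = [5] \<and>
     (\<forall>j<length (chains L). j \<noteq> i \<longrightarrow> chains L ! j = [] \<or> chains L ! j = [2])"
  by (simp_all add: type_of_sizes_def Let_def)

lemma joined_of_type:
  assumes type: "type_of_sizes t L" "type_of_sizes t L'"
    and pos: "0 \<notin> set L" "0 \<notin> set L'"
    and P: "mset (cyc_lens L) = mset (cyc_lens L')"
    and M: "last (cyc_lens L) = last (cyc_lens L')"
  shows "joined L L'"
proof -
  define cs d cs' d' where "cs = butlast (chains L)" "d = last (chains L)"
    "cs' = butlast (chains L')" "d' = last (chains L')"
  then have ch: "chains L = cs @ [d]" "chains L' = cs' @ [d']"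
    and L: "L = chained cs d" "L' = chained cs' d'"
    by (simp_all add: chained_chains)
  have P': "cycle_mset (mset cs + {#d#}) = cycle_mset (mset cs' + {#d'#})"
    using P unfolding L mset_cyc_lens_chained .
  have M': "last (cyc_lens d) = last (cyc_lens d')"
    using M unfolding L last_cyc_lens_chained .
  from type(1) consider "t = 1" | "t = 2" | "t = 3" | "t = 4" | "t = 5"
    unfolding type_of_sizes_def Let_def by blast
  then show ?thesis
  proof cases
    case 1
    from type have 1: "length (filter (\<lambda>c. c \<noteq> []) (chains L)) \<le> 1"
      "\<forall>c\<in>set (chains L). c \<noteq> [] \<longrightarrow> length c = 1"
      "length (filter (\<lambda>c. c \<noteq> []) (chains L')) \<le> 1"
      "\<forall>c\<in>set (chains L'). c \<noteq> [] \<longrightarrow> length c = 1"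
      unfolding 1 type_of_sizes_simps(1) by blast+
    have single: "\<exists>k\<ge>2. c = [k]"
      if "c \<noteq> [] \<longrightarrow> length c = 1" "c \<in> set (chains K)" "0 \<notin> set K" "c \<noteq> []" for c K
    proof -
      from that obtain k where c: "c = [k]" by (cases c) auto
      with in_chains[OF that(2), of k] have "k \<in> set K" "k \<noteq> 1" by auto
      with that(3) have "2 \<le> k" by (metis One_nat_def Suc_1 Suc_leI le_neq_implies_less not_gr0)
      with c show ?thesis by blast
    qed
    have size: "size (filter_mset (\<lambda>c. c \<noteq> []) (mset xs)) = length (filter (\<lambda>c. c \<noteq> []) xs)"
      for xs :: "nat list list"
      by (metis mset_filter size_mset)
    show ?thesis
      unfolding L
    proof (rule joined_type1[OF _ _ _ _ P' M'])
      show "\<exists>k\<ge>2. c = [k]" if "c \<in># mset cs + {#d#}" "c \<noteq> []" for c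
        using single[of c L] 1(2) pos(1) that unfolding ch by auto
      show "\<exists>k\<ge>2. c = [k]" if "c \<in># mset cs' + {#d'#}" "c \<noteq> []" for c
        using single[of c L'] 1(4) pos(2) that unfolding ch by auto
    qed (use 1(1,3) size[of "cs @ [d]"] size[of "cs' @ [d']"] ch in simp_all)
  next
    case 2
    note 2 = type[unfolded 2, THEN type_of_sizes_simps(2)]
    then have "all_twos (mset cs + {#d#})" "all_twos (mset cs' + {#d'#})"
      unfolding all_twos_def ch by (auto intro: all_2_twos)
    then show ?thesis unfolding L using P' M' by (rule joined_type2)
  next
    case 3
    note 3 = type[unfolded 3, THEN type_of_sizes_simps(3)]
    have form: "(\<exists>p. c = three p) \<or> (\<exists>m. c = twos m)"
      if "c \<noteq> [] \<longrightarrow> (\<exists>m l. c = replicate m 2 @ [3] @ replicate l 2) \<or> (\<exists>m\<ge>1. c = replicate m 2)" for c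
    proof (cases "c = []")
      case True
      then have "c = twos 0" by simp
      then show ?thesis by blast
    next
      case False
      with that consider m l where "c = replicate m 2 @ [3] @ replicate l 2" | m where "c = twos m"
        by blast
      then show ?thesis
      proof cases
        case (1 m l)
        then have "c = three (m, l)" by (simp add: three_def)
        then show ?thesis by blast
      qed blast
    qed
    show ?thesis unfolding L
      by (intro joined_type3[OF _ _ P' M'] ballI form[OF bspec[OF 3(1)[unfolded ch]]]
          form[OF bspec[OF 3(2)[unfolded ch]]])
  next
    case 4
    obtain i i' where 4: "i < length (chains L)" "\<exists>m. chains L ! i = 4 # replicate m 2"
      "\<forall>j<length (chains L). j \<noteq> i \<longrightarrow> (\<forall>s\<in>set (chains L ! j). s = 2)"
      "i' < length (chains L')" "\<exists>m. chains L' ! i' = 4 # replicate m 2"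
      "\<forall>j<length (chains L'). j \<noteq> i' \<longrightarrow> (\<forall>s\<in>set (chains L' ! j). s = 2)"
      using type[unfolded 4, THEN type_of_sizes_simps(4)] by blast
    have "(\<exists>m A. mset cs = add_mset (4 # twos m) A \<and> all_twos (add_mset d A)) \<or>
      (\<exists>m. d = 4 # twos m \<and> all_twos (mset cs))"
    proof -
      have "\<exists>m. chains L ! j = twos m" if "j < length (chains L)" "j \<noteq> i" for j
        using 4(3) that by (intro all_2_twos) blast
      from split_special_chain[OF ch(1) 4(1), where P = "\<lambda>c. \<exists>m. c = 4 # twos m", OF 4(2) this]
      show ?thesis by blast
    qed
    moreover have "(\<exists>m A. mset cs' = add_mset (4 # twos m) A \<and> all_twos (add_mset d' A)) \<or>
      (\<exists>m. d' = 4 # twos m \<and> all_twos (mset cs'))"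
    proof -
      have "\<exists>m. chains L' ! j = twos m" if "j < length (chains L')" "j \<noteq> i'" for j
        using 4(6) that by (intro all_2_twos) blast
      from split_special_chain[OF ch(2) 4(4), where P = "\<lambda>c. \<exists>m. c = 4 # twos m", OF 4(5) this]
      show ?thesis by blast
    qed
    ultimately show ?thesis unfolding L using P' M' by (rule joined_type4)
  next
    case 5
    obtain i i' where 5: "i < length (chains L)" "chains L ! i = [5]"
      "\<forall>j<length (chains L). j \<noteq> i \<longrightarrow> chains L ! j = [] \<or> chains L ! j = [2]"
      "i' < length (chains L')" "chains L' ! i' = [5]"
      "\<forall>j<length (chains L'). j \<noteq> i' \<longrightarrow> chains L' ! j = [] \<or> chains L' ! j = [2]"
      using type[unfolded 5, THEN type_of_sizes_simps(5)] by blast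
    have twos: "\<exists>m. c = twos m" if "c = [] \<or> c = [2]" for c
      using that all_2_twos[of c] by auto
    have "(\<exists>A. mset cs = add_mset [5] A \<and> all_twos (add_mset d A)) \<or> d = [5] \<and> all_twos (mset cs)"
    proof -
      have "\<exists>m. chains L ! j = twos m" if "j < length (chains L)" "j \<noteq> i" for j
        using 5(3) that by (intro twos) blast
      from split_special_chain[OF ch(1) 5(1), where P = "\<lambda>c. c = [5]", OF 5(2) this]
      show ?thesis by blast
    qed
    moreover have "(\<exists>A. mset cs' = add_mset [5] A \<and> all_twos (add_mset d' A)) \<or>
        d' = [5] \<and> all_twos (mset cs')"
    proof -
      have "\<exists>m. chains L' ! j = twos m" if "j < length (chains L')" "j \<noteq> i'" for j
        using 5(6) that by (intro twos) blast
      from split_special_chain[OF ch(2) 5(4), where P = "\<lambda>c. c = [5]", OF 5(5) this]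
      show ?thesis by blast
    qed
    ultimately show ?thesis unfolding L using P' M' by (rule joined_type5)
  qed
qed

subsection \<open>Pairs as pairs of words\<close>

text \<open>Places count from 1 as in the rows of a pair, whereas \<open>!\<close> counts from 0;
  therefore \<open>t ! pos t x\<close> is the letter after \<open>x\<close>.\<close>

definition pos :: "'a list \<Rightarrow> 'a \<Rightarrow> nat" where
  "pos xs x = Suc (length (takeWhile (\<lambda>y. y \<noteq> x) xs))"

lemma pos_Cons: "pos (y # ys) x = (if x = y then 1 else Suc (pos ys x))"
  by (simp add: pos_def)

lemma pos_append: "pos (xs @ ys) x = (if x \<in> set xs then pos xs x else length xs + pos ys x)"
  by (induction xs) (auto simp: pos_Cons)

lemma pos_le: "x \<in> set xs \<Longrightarrow> pos xs x \<le> length xs"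
  by (induction xs) (auto simp: pos_Cons)

lemma pos_neq_0 [simp]: "pos xs x \<noteq> 0"
  by (simp add: pos_def)

lemma pos_nth: "distinct xs \<Longrightarrow> i < length xs \<Longrightarrow> pos xs (xs ! i) = Suc i"
  by (induction xs arbitrary: i) (auto simp: pos_Cons nth_Cons split: nat.splits)

lemma nth_pos: "x \<in> set xs \<Longrightarrow> xs ! (pos xs x - 1) = x"
  by (induction xs) (auto simp: pos_Cons nth_Cons split: nat.splits)

definition labels :: "'a list \<Rightarrow> bool" where
  "labels xs \<longleftrightarrow> distinct xs \<and> set xs = UNIV"

lemma labels_mset: "mset xs = mset ys \<Longrightarrow> labels xs = labels ys"
  unfolding labels_def by (metis mset_eq_imp_distinct_iff mset_eq_setD)

lemma labels_length: "labels (xs :: 'a::finite list) \<Longrightarrow> length xs = CARD('a)"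
  unfolding labels_def by (metis distinct_card)

lemma inj_pos:
  assumes "labels xs"
  shows "inj (pos xs)"
proof (rule injI)
  fix x y
  assume "pos xs x = pos xs y"
  moreover have "x \<in> set xs" "y \<in> set xs" using assms by (simp_all add: labels_def)
  ultimately show "x = y" by (metis nth_pos)
qed

lemma inv_pos: "labels xs \<Longrightarrow> i < length xs \<Longrightarrow> inv (pos xs) (Suc i) = xs ! i"
  by (intro inv_f_eq inj_pos pos_nth) (auto simp: labels_def)

lemma inv_pos_last: "labels (xs @ [z]) \<Longrightarrow> inv (pos (xs @ [z])) (CARD('a)) = (z :: 'a::finite)"
  using inv_pos[of "xs @ [z]" "length xs"] labels_length[of "xs @ [z]"] by simp

definition pair_of :: "'a list \<times> 'a list \<Rightarrow> 'a::finite pair" where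
  "pair_of w = (pos (fst w), pos (snd w))"

lemma move_row_pos:
  fixes z :: "'a::finite"
  assumes "labels (t @ [z])" "labels (U @ z # V @ [w])"
  shows "move_row (pos (t @ [z])) (pos (U @ z # V @ [w])) = pos (U @ z # w # V)"
proof
  fix b
  have n: "CARD('a) = length U + length V + 2" using labels_length[OF assms(2)] by simp
  have "b \<in> set U \<or> b = z \<or> b \<in> set V \<or> b = w" "z \<notin> set U" "w \<notin> set U" "w \<noteq> z" "w \<notin> set V"
    "b \<in> set V \<Longrightarrow> b \<notin> set U" "z \<notin> set V"
    using assms(2) unfolding labels_def by auto
  then show "move_row (pos (t @ [z])) (pos (U @ z # V @ [w])) b = pos (U @ z # w # V) b"
    using pos_le[of b U] pos_le[of b V] unfolding move_row_def inv_pos_last[OF assms(1)] Let_def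
    by (auto simp: pos_append pos_Cons n)
qed

text \<open>Each move takes the last bottom letter to the place right after \<open>z\<close>. The
  top row does not change, so \<open>z\<close> stays in charge and the moves can be repeated until
  all of \<open>R\<close> is transferred.\<close>

lemma rauzy_rotate_bottom:
  assumes "labels (t @ [z])" "labels (U @ z # V @ R)"
  shows "rauzy_step\<^sup>*\<^sup>* (pair_of (t @ [z], U @ z # V @ R)) (pair_of (t @ [z], U @ z # R @ V))"
  using assms(2)
proof (induction R arbitrary: V rule: rev_induct)
  case (snoc r R)
  have "labels (U @ z # (V @ R) @ [r])" using snoc.prems by simp
  from move_row_pos[OF assms(1) this]
  have "rauzy_step (pair_of (t @ [z], U @ z # V @ R @ [r])) (pair_of (t @ [z], U @ z # (r # V) @ R))"
    by (simp add: rauzy_step_def rauzy0_def pair_of_def)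
  moreover have "labels (U @ z # (r # V) @ R)"
    using snoc.prems labels_mset[of "U @ z # V @ R @ [r]" "U @ z # (r # V) @ R"] by simp
  from snoc.IH[OF this]
  have "rauzy_step\<^sup>*\<^sup>* (pair_of (t @ [z], U @ z # (r # V) @ R)) (pair_of (t @ [z], U @ z # (R @ [r]) @ V))"
    by simp
  ultimately show ?case by (rule converse_rtranclp_into_rtranclp)
qed simp

lemma rauzy_rotate_top:
  assumes "labels (t @ [z])" "labels (U @ z # V @ R)"
  shows "rauzy_step\<^sup>*\<^sup>* (pair_of (U @ z # V @ R, t @ [z])) (pair_of (U @ z # R @ V, t @ [z]))"
proof -
  \<comment> \<open>Interchanging the two rows interchanges the two types of moves.\<close>
  have step: "rauzy_step (prod.swap p) (prod.swap q)" if "rauzy_step p q" for p q :: "'a pair"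
    using that by (auto simp: rauzy_step_def rauzy0_def rauzy1_def prod.swap_def)
  have "rauzy_step\<^sup>*\<^sup>* (prod.swap p) (prod.swap q)" if "rauzy_step\<^sup>*\<^sup>* p q" for p q :: "'a pair"
    using that by (induction rule: rtranclp_induct) (auto intro: step rtranclp.rtrancl_into_rtrancl)
  from this[OF rauzy_rotate_bottom[OF assms]] show ?thesis
    by (simp add: pair_of_def prod.swap_def)
qed

definition frame :: "'a \<Rightarrow> 'a \<Rightarrow> 'a list \<times> 'a list \<Rightarrow> 'a list \<times> 'a list" where
  "frame a z w = (a # fst w @ [z], z # snd w @ [a])"

definition labelled :: "'a list \<times> 'a list \<Rightarrow> bool" where
  "labelled w \<longleftrightarrow> labels (fst w) \<and> labels (snd w)"

lemma labelled_swap: "swap v w \<Longrightarrow> labelled (frame a z v) = labelled (frame a z w)"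
  unfolding labelled_def frame_def
  using swap_mset[of v w] labels_mset[of "a # fst v @ [z]" "a # fst w @ [z]"]
    labels_mset[of "z # snd v @ [a]" "z # snd w @ [a]"] by simp

text \<open>A rotation acts behind the letter that ends the other row, and these letters are
  \<open>z\<close>, \<open>s\<close>, \<open>s'\<close>, \<open>a\<close> in turn. Each of the first
  three rotations ends its row with the letter that controls the next one; the last two also bring
  \<open>a\<close> and \<open>z\<close> back to the ends.\<close>

lemma rauzy_swap:
  assumes "swap v w" "labelled (frame a z v)"
  shows "rauzy_step\<^sup>*\<^sup>* (pair_of (frame a z v)) (pair_of (frame a z w))"
  using assms
proof (cases rule: swap.cases)
  case (1 X s Y s' W X' Y' W')
  let ?t = "a # X @ s # Y @ s' # W @ [z]" and ?b = "z # X' @ s # Y' @ s' # W' @ [a]"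
  have lt: "labels t \<longleftrightarrow> True" if "mset t = mset ?t" for t
    using labels_mset[OF that] assms(2) 1 by (simp add: labelled_def frame_def)
  have lb: "labels b \<longleftrightarrow> True" if "mset b = mset ?b" for b
    using labels_mset[OF that] assms(2) 1 by (simp add: labelled_def frame_def)
  have "rauzy_step\<^sup>*\<^sup>* (pair_of (?t, ?b)) (pair_of (?t, z # (Y' @ s' # W' @ [a]) @ X' @ [s]))"
    using rauzy_rotate_bottom[of "a # X @ s # Y @ s' # W" z "[]" "X' @ [s]" "Y' @ s' # W' @ [a]"] lt lb
    by simp
  also have "rauzy_step\<^sup>*\<^sup>* \<dots> (pair_of (a # X @ s # W @ z # Y @ [s'], z # Y' @ s' # W' @ a # X' @ [s]))"
    using rauzy_rotate_top[of "z # Y' @ s' # W' @ a # X'" s "a # X" "Y @ [s']" "W @ [z]"] lt lb by simp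
  also have "rauzy_step\<^sup>*\<^sup>* \<dots> (pair_of (a # X @ s # W @ z # Y @ [s'], z # Y' @ s' # X' @ s # W' @ [a]))"
    using rauzy_rotate_bottom[of "a # X @ s # W @ z # Y" s' "z # Y'" "W' @ [a]" "X' @ [s]"] lt lb by simp
  also have "rauzy_step\<^sup>*\<^sup>* \<dots> (pair_of (a # Y @ s' # X @ s # W @ [z], z # Y' @ s' # X' @ s # W' @ [a]))"
    using rauzy_rotate_top[of "z # Y' @ s' # X' @ s # W'" a "[]" "X @ s # W @ [z]" "Y @ [s']"] lt lb by simp
  finally show ?thesis by (simp add: 1 frame_def)
qed

lemma rauzy_swaps:
  assumes "swap\<^sup>*\<^sup>* v w" "labelled (frame a z v)"
  shows "rauzy_step\<^sup>*\<^sup>* (pair_of (frame a z v)) (pair_of (frame a z w)) \<and> labelled (frame a z w)"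
  using assms by (induction rule: rtranclp_induct) (auto dest: rauzy_swap labelled_swap intro: rtranclp_trans)

subsection \<open>Non-labeled classes\<close>

lemma nonlabeled_rauzy_class_eq:
  assumes "rauzy_step\<^sup>*\<^sup>* p q" "rauzy_step\<^sup>*\<^sup>* q p"
  shows "nonlabeled_rauzy_class p = nonlabeled_rauzy_class q"
proof -
  have "labeled_rauzy_class p = labeled_rauzy_class q"
    using assms unfolding labeled_rauzy_class_def by (auto intro: rtranclp_trans)
  then show ?thesis by (simp add: nonlabeled_rauzy_class_def)
qed

section \<open>Invariance of the non-labeled class under relabelling\<close>

definition relabel :: "('a \<Rightarrow> 'a) \<Rightarrow> 'a::finite pair \<Rightarrow> 'a pair" where
  "relabel f p = (fst p \<circ> f, snd p \<circ> f)"

lemma inv_comp_apply: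
  assumes "bij f" "inj g" "k \<in> range g"
  shows "f (inv (g \<circ> f) k) = inv g k"
proof -
  from assms(3) obtain x where x: "k = g x" by blast
  have "inv (g \<circ> f) k = inv f x"
    using assms by (intro inv_f_eq) (auto simp: x bij_is_inj inj_compose bij_is_surj surj_f_inv_f)
  then show ?thesis using assms by (simp add: x bij_is_surj surj_f_inv_f)
qed

lemma is_pairD:
  fixes p :: "'a::finite pair"
  assumes "is_pair p"
  shows "inj (fst p)" "inj (snd p)" "range (fst p) = {1..CARD('a)}" "range (snd p) = {1..CARD('a)}"
  using assms by (auto simp: is_pair_def bij_betw_def)

lemma card_in_range:
  fixes p :: "'a::finite pair"
  assumes "is_pair p"
  shows "CARD('a) \<in> range (fst p)" "CARD('a) \<in> range (snd p)"
  using is_pairD[OF assms] by (simp_all add: Suc_leI)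

lemma is_pair_iff:
  fixes p :: "'a::finite pair"
  shows "is_pair p \<longleftrightarrow> inj (fst p) \<and> inj (snd p) \<and> range (fst p) \<subseteq> {1..CARD('a)} \<and> range (snd p) \<subseteq> {1..CARD('a)}"
proof -
  have "range f = {1..CARD('a)}" if "inj f" "range f \<subseteq> {1..CARD('a)}" for f :: "'a \<Rightarrow> nat"
    using that by (intro card_subset_eq) (simp_all add: card_image)
  then show ?thesis unfolding is_pair_def bij_betw_def by (metis order_refl)
qed

lemma move_row_comp:
  fixes r q :: "'a::finite \<Rightarrow> nat" and f :: "'a \<Rightarrow> 'a"
  assumes "bij f" "inj q" "CARD('a) \<in> range q"
  shows "move_row (q \<circ> f) (r \<circ> f) = move_row q r \<circ> f"
  using inv_comp_apply[OF assms] by (auto simp: move_row_def Let_def fun_eq_iff)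

lemma inj_range_move_row:
  fixes q r :: "'a::finite \<Rightarrow> nat"
  assumes "inj r" "range r \<subseteq> {1..CARD('a)}"
  shows "inj (move_row q r) \<and> range (move_row q r) \<subseteq> {1..CARD('a)}"
proof -
  define N z where "N = CARD('a)" "z = r (inv q (CARD('a)))"
  have r: "r b \<in> {1..N}" for b
    using subsetD[OF assms(2) rangeI, of b] by (simp add: N_z_def)
  have z: "z \<in> {1..N}" using r by (simp add: N_z_def)
  have mr: "move_row q r b = (if r b \<le> z then r b else if r b < N then r b + 1 else z + 1)" for b
    by (simp add: move_row_def Let_def N_z_def)
  have "r b = r c" if "move_row q r b = move_row q r c" for b c
    using that r[of b] r[of c] z unfolding mr atLeastAtMost_iff by presburger
  moreover have "move_row q r b \<in> {1..N}" for b
    using r[of b] z unfolding mr atLeastAtMost_iff by presburger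
  ultimately show ?thesis
    using injD[OF assms(1)] unfolding N_z_def(1) by (intro conjI injI image_subsetI) blast+
qed

lemma is_pair_step: "is_pair p \<Longrightarrow> rauzy_step p q \<Longrightarrow> is_pair q"
  unfolding is_pair_iff rauzy_step_def rauzy0_def rauzy1_def using inj_range_move_row by (elim disjE conjE) simp_all

lemma relabel_step:
  assumes "bij f" "is_pair p" "rauzy_step p q"
  shows "rauzy_step (relabel f p) (relabel f q)"
  using assms(3) is_pairD[OF assms(2)] card_in_range[OF assms(2)] move_row_comp[OF assms(1)]
  by (auto simp: rauzy_step_def rauzy0_def rauzy1_def relabel_def)

lemma relabel_steps:
  assumes "rauzy_step\<^sup>*\<^sup>* p q" "bij f" "is_pair p"
  shows "rauzy_step\<^sup>*\<^sup>* (relabel f p) (relabel f q) \<and> is_pair q"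
  using assms
  by (induction rule: rtranclp_induct) (auto intro: is_pair_step relabel_step rtranclp.rtrancl_into_rtrancl)

lemma unlabel_relabel:
  assumes "bij f" "is_pair p"
  shows "unlabel (relabel f p) = unlabel p"
  using inv_comp_apply[OF assms(1) is_pairD(1)[OF assms(2)]] is_pairD(3)[OF assms(2)]
  by (auto simp: unlabel_def relabel_def)

lemma nonlabeled_rauzy_class_relabel_subset:
  assumes "bij f" "is_pair p"
  shows "nonlabeled_rauzy_class p \<subseteq> nonlabeled_rauzy_class (relabel f p)"
proof
  fix u
  assume "u \<in> nonlabeled_rauzy_class p"
  then obtain q where q: "rauzy_step\<^sup>*\<^sup>* p q" "u = unlabel q"
    by (auto simp: nonlabeled_rauzy_class_def labeled_rauzy_class_def)
  with relabel_steps[OF q(1) assms] unlabel_relabel[OF assms(1), of q]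
  show "u \<in> nonlabeled_rauzy_class (relabel f p)"
    by (auto simp: nonlabeled_rauzy_class_def labeled_rauzy_class_def intro!: image_eqI[of _ _ "relabel f q"])
qed

lemma nonlabeled_rauzy_class_relabel:
  assumes "bij f" "is_pair p"
  shows "nonlabeled_rauzy_class (relabel f p) = nonlabeled_rauzy_class p"
proof
  \<comment> \<open>The reverse inclusion is the inclusion already known, applied to the inverse
    relabelling.\<close>
  have inv: "relabel (inv f) (relabel f p) = p"
    using iffD1[OF surj_iff bij_is_surj[OF assms(1)]] by (simp add: relabel_def comp_assoc)
  have "is_pair (relabel f p)"
    using assms by (auto simp: is_pair_iff relabel_def bij_is_inj inj_compose)
  from nonlabeled_rauzy_class_relabel_subset[OF bij_imp_bij_inv[OF assms(1)] this]
  show "nonlabeled_rauzy_class (relabel f p) \<subseteq> nonlabeled_rauzy_class p"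
    unfolding inv .
qed (rule nonlabeled_rauzy_class_relabel_subset[OF assms])

lemma is_pair_pair_of:
  assumes "labelled w"
  shows "is_pair (pair_of w)"
proof -
  have "range (pos xs) \<subseteq> {1..CARD('a)}" if "labels xs" for xs :: "'a list"
  proof (rule image_subsetI)
    fix x
    show "pos xs x \<in> {1..CARD('a)}"
      using pos_le[of x xs] that labels_length[OF that] by (simp add: labels_def) (simp add: pos_def)
  qed
  with assms show ?thesis by (simp add: is_pair_iff pair_of_def labelled_def inj_pos)
qed

subsection \<open>Block arrangements\<close>

definition arranged :: "'a::finite pair \<Rightarrow> nat list \<Rightarrow> bool" where
  "arranged p L \<longleftrightarrow> (\<exists>a z bs. map length bs = L \<and> p = pair_of (frame a z (block_words bs)) \<and>
     labelled (frame a z (block_words bs)))"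

lemma block_words_map: "map_prod (map f) (map f) (block_words bs) = block_words (map (map f) bs)"
  by (simp add: block_words_def map_concat rev_map comp_def)

lemma arranged_conn:
  fixes p :: "'a::finite pair"
  assumes "arranged p L" "conn L L'"
  shows "\<exists>p' :: 'a pair. arranged p' L' \<and> nonlabeled_rauzy_class p' = nonlabeled_rauzy_class p"
proof -
  from assms(1) obtain a z bs where len: "map length bs = L"
    and p: "p = pair_of (frame a z (block_words bs))" "labelled (frame a z (block_words bs))"
    by (auto simp: arranged_def)
  \<comment> \<open>The blocks are transported to \<open>nat\<close>, where \<open>conn\<close>
    applies, and the resulting exchanges are carried back by \<open>inv h\<close>.\<close>
  obtain h :: "'a \<Rightarrow> nat" where h: "inj h"
    using finite_imp_inj_to_nat_seg[of "UNIV :: 'a set"] by auto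
  have "map length (map (map h) bs) = L" using len by (simp add: comp_def)
  then obtain bs' where len': "map length bs' = L'"
    and sw: "swap\<^sup>*\<^sup>* (block_words (map (map h) bs)) (block_words bs')"
    using assms(2) unfolding conn_def by blast
  define cs where "cs = map (map (inv h)) bs'"
  have "map (map (inv h)) (map (map h) bs) = bs"
    using h by (simp add: comp_def)
  with swaps_map[OF sw, of "inv h"] have sw: "swap\<^sup>*\<^sup>* (block_words bs) (block_words cs)"
    by (simp add: block_words_map cs_def del: map_map)
  \<comment> \<open>Since exchanges are symmetric, the way back needs no inverse of a Rauzy
    move.\<close>
  have sw': "swap\<^sup>*\<^sup>* (block_words cs) (block_words bs)"
    using sw symp_rtranclp[OF symp_swap] by (auto dest: sympD)
  from rauzy_swaps[OF sw p(2)] have 1: "rauzy_step\<^sup>*\<^sup>* p (pair_of (frame a z (block_words cs)))"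
    "labelled (frame a z (block_words cs))" by (auto simp: p)
  from rauzy_swaps[OF sw' 1(2)] have 2: "rauzy_step\<^sup>*\<^sup>* (pair_of (frame a z (block_words cs))) p"
    by (auto simp: p)
  have "map length cs = L'" using len' by (simp add: cs_def comp_def)
  with 1(2) have "arranged (pair_of (frame a z (block_words cs))) L'" by (auto simp: arranged_def)
  with nonlabeled_rauzy_class_eq[OF 2 1(1)] show ?thesis
    by blast
qed

lemma map_map_eq_if_map_concat_eq:
  "map f (concat xss) = concat yss \<Longrightarrow> map length xss = map length yss \<Longrightarrow> map (map f) xss = yss"
proof (induction xss arbitrary: yss)
  case (Cons xs xss)
  then show ?case by (cases yss) auto
qed auto

lemma pos_map: "inj f \<Longrightarrow> pos (map f xs) (f x) = pos xs x"
  by (induction xs) (auto simp: pos_Cons inj_eq, simp add: pos_def)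

lemma relabel_pair_of: "inj f \<Longrightarrow> relabel f (pair_of (map_prod (map f) (map f) w)) = pair_of w"
  by (simp add: relabel_def pair_of_def fun_eq_iff pos_map)

text \<open>The top rows determine a bijection of the alphabet, and equal block sizes force it to
  match the bottom rows too.\<close>

lemma arranged_unique:
  fixes p q :: "'a::finite pair"
  assumes "arranged p L" "arranged q L"
  shows "nonlabeled_rauzy_class p = nonlabeled_rauzy_class q"
proof -
  from assms(1) obtain a z bs where len: "map length bs = L"
    and p: "p = pair_of (frame a z (block_words bs))" "labelled (frame a z (block_words bs))"
    by (auto simp: arranged_def)
  from assms(2) obtain a' z' bs' where len': "map length bs' = L"
    and q: "q = pair_of (frame a' z' (block_words bs'))" "labelled (frame a' z' (block_words bs'))"
    by (auto simp: arranged_def)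
  define t t' where t: "t = a # concat bs @ [z]" "t' = a' # concat bs' @ [z']"
  have lt: "labels t" "labels t'" using p q by (auto simp: t labelled_def frame_def block_words_def)
  have l: "length t = length t'" using labels_length lt by metis
  \<comment> \<open>The letter of \<open>t'\<close> at the place of \<open>x\<close> in
    \<open>t\<close>; the 1 corrects between the counting of \<open>pos\<close> and of
    \<open>!\<close>.\<close>
  define f where "f x = t' ! (pos t x - 1)" for x
  have mt: "map f t = t'"
    using lt l by (intro nth_equalityI) (auto simp: f_def pos_nth labels_def)
  have "surj f" using lt(2) mt unfolding labels_def by (metis UNIV_I UNIV_eq_I image_iff list.set_map)
  then have bij: "bij f" by (simp add: bij_def finite_UNIV_surj_inj)
  have "length (concat bs) = length (concat bs')" using len len' by (simp add: length_concat)
  with mt have fs: "f a = a'" "f z = z'" "map f (concat bs) = concat bs'" by (auto simp: t)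
  then have "map (map f) bs = bs'" using len len' map_map_eq_if_map_concat_eq by metis
  then have "block_words bs' = map_prod (map f) (map f) (block_words bs)" by (simp add: block_words_map)
  then have "frame a' z' (block_words bs') = map_prod (map f) (map f) (frame a z (block_words bs))"
    using fs(1,2) by (simp add: frame_def)
  then have "p = relabel f q" using bij by (simp add: p q relabel_pair_of bij_is_inj)
  then show ?thesis using nonlabeled_rauzy_class_relabel[OF bij is_pair_pair_of[OF q(2)]] q(1) by simp
qed

lemma joined_class_eq:
  fixes p q :: "'a::finite pair"
  assumes "arranged p L" "arranged q L'" "joined L L'"
  shows "nonlabeled_rauzy_class p = nonlabeled_rauzy_class q"
proof -
  obtain C where C: "conn L C" "conn L' C" using assms(3) unfolding joined_def by blast
  obtain p' :: "'a pair" where p': "arranged p' C" "nonlabeled_rauzy_class p' = nonlabeled_rauzy_class p"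
    using arranged_conn[OF assms(1) C(1)] by blast
  obtain q' :: "'a pair" where q': "arranged q' C" "nonlabeled_rauzy_class q' = nonlabeled_rauzy_class q"
    using arranged_conn[OF assms(2) C(2)] by blast
  from arranged_unique[OF p'(1) q'(1)] p'(2) q'(2) show ?thesis by simp
qed

subsection \<open>Cycle structure\<close>

text \<open>The end point \<open>y\<close> is the image of the last listed letter and is not itself
  part of the path, so a cycle is a nonempty path from \<open>x\<close> to \<open>x\<close>.\<close>

fun path :: "('a \<Rightarrow> 'a) \<Rightarrow> 'a \<Rightarrow> 'a list \<Rightarrow> 'a \<Rightarrow> bool" where
  "path F x [] y \<longleftrightarrow> x = y"
| "path F x (a # as) y \<longleftrightarrow> x = a \<and> path F (F a) as y"

lemma path_append: "path F x (xs @ ys) y \<longleftrightarrow> (\<exists>m. path F x xs m \<and> path F m ys y)"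
  by (induction xs arbitrary: x) auto

lemma path_funpow: "path F x xs y \<Longrightarrow> (F ^^ length xs) x = y \<and> xs = map (\<lambda>i. (F ^^ i) x) [0..<length xs]"
proof (induction xs arbitrary: x)
  case (Cons a xs)
  then have "(F ^^ length xs) (F x) = y" "xs = map (\<lambda>i. (F ^^ i) (F x)) [0..<length xs]" and "a = x"
    by auto
  then have "(F ^^ Suc (length xs)) x = y" "xs = map (\<lambda>i. (F ^^ Suc i) x) [0..<length xs]"
    by (simp_all add: funpow_swap1)
  then show ?case using \<open>a = x\<close>
    by (simp add: upt_conv_Cons map_Suc_upt[symmetric] comp_def del: upt_Suc mset_upt funpow.simps)
qed simp

lemma orbit_of_cycle_start:
  assumes "path F x xs x" "xs \<noteq> []"
  shows "orbit_of F x = set xs"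
proof -
  have *: "(F ^^ length xs) x = x" "xs = map (\<lambda>i. (F ^^ i) x) [0..<length xs]"
    using path_funpow[OF assms(1)] by auto
  have "(F ^^ k) x \<in> set xs" for k
  proof -
    have "(F ^^ (k mod length xs)) x \<in> (\<lambda>i. (F ^^ i) x) ` {0..<length xs}"
      using assms(2) by (intro imageI) simp
    then show ?thesis
      using funpow_mod_eq[OF *(1), of k] arg_cong[OF *(2), of set] by simp
  qed
  moreover have "set xs \<subseteq> orbit_of F x"
    using arg_cong[OF *(2), of set] by (auto simp: orbit_of_def)
  ultimately show ?thesis by (auto simp: orbit_of_def)
qed

lemma cycle_rotate:
  assumes "path F x xs x" "y \<in> set xs"
  shows "\<exists>ys. path F y (y # ys) y \<and> mset (y # ys) = mset xs"
proof -
  from assms(2) obtain us vs where xs: "xs = us @ y # vs" by (meson split_list)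
  with assms(1) have "path F y (y # vs @ us) y" by (auto simp: path_append)
  then show ?thesis by (intro exI[of _ "vs @ us"]) (simp add: xs)
qed

lemma orbit_of_cycle:
  assumes "path F x xs x" "y \<in> set xs"
  shows "orbit_of F y = set xs"
proof -
  obtain ys where "path F y (y # ys) y" "mset (y # ys) = mset xs"
    using cycle_rotate[OF assms] by blast
  then show ?thesis using orbit_of_cycle_start[of F y "y # ys"] by (metis list.discI mset_eq_setD)
qed

text \<open>Positions are counted from \<open>c\<close> on, \<open>e\<close> turns them into letters, and a final 1-block is understood.
  The number \<open>k'\<close> is the size of the block preceding position \<open>c\<close> (1 if there is none), so
  \<open>c + 1 - k'\<close> is the second place of that block, or \<open>c\<close> itself if \<open>k' = 1\<close>.\<close>

fun block_map :: "('a \<Rightarrow> 'a) \<Rightarrow> (nat \<Rightarrow> 'a) \<Rightarrow> nat \<Rightarrow> nat \<Rightarrow> nat list \<Rightarrow> bool" where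
  "block_map F e k' c [] \<longleftrightarrow> F (e c) = e (c + 1 - k')"
| "block_map F e k' c (k # L) \<longleftrightarrow> (\<forall>j. c \<le> j \<and> Suc j < c + k \<longrightarrow> F (e j) = e (j + 2)) \<and>
     F (e (c + k - 1)) = e (c + 1 - k') \<and> block_map F e k (c + k) L"

definition every_other :: "nat \<Rightarrow> nat \<Rightarrow> nat list" where
  "every_other c h = map (\<lambda>i. c + 2 * i) [0..<h]"

lemma length_every_other [simp]: "length (every_other c h) = h"
  by (simp add: every_other_def)

lemma every_other_Suc: "every_other c (Suc h) = every_other c h @ [c + 2 * h]"
  by (simp add: every_other_def)

lemma path_every_other:
  assumes "\<And>i. i < h \<Longrightarrow> F (e (c + 2 * i)) = e (c + 2 * i + 2)"
  shows "path F (e c) (map e (every_other c h)) (e (c + 2 * h))"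
  using assms
proof (induction h)
  case (Suc h)
  then have "path F (e c) (map e (every_other c h)) (e (c + 2 * h))" by simp
  with Suc.prems[of h] show ?case by (auto simp: every_other_Suc path_append)
qed (simp add: every_other_def)

lemma mset_every_other: "mset (every_other c h) + mset (every_other (Suc c) h) = mset [c..<c + 2 * h]"
  by (induction h) (simp_all add: every_other_Suc del: mset_upt, simp add: every_other_def)

definition closed_path :: "('a \<Rightarrow> 'a) \<Rightarrow> 'a list \<Rightarrow> bool" where
  "closed_path F xs \<longleftrightarrow> (\<exists>x. path F x xs x)"

text \<open>Inside a block the map jumps two places ahead, so the two parity classes of places are
  traversed separately; one of them runs on into the next block, whose path returns to the second
  place of this block. The head \<open>xs\<close> is the path still open towards the preceding
  block, and the other lists are already closed. For \<open>k' = 1\<close> the head closes as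
  well.\<close>

lemma block_map_cycles:
  assumes "block_map F e k' c L" "0 \<notin> set L"
  shows "\<exists>xs css. map length (xs # css) = cyc_lens L \<and> [] \<notin> set (xs # css) \<and>
    path F (e c) (map e xs) (e (c + 1 - k')) \<and> (\<forall>ys\<in>set css. closed_path F (map e ys)) \<and>
    mset (concat (xs # css)) = mset [c..<Suc (c + sum_list L)] \<and>
    c + sum_list L \<in> set (last (xs # css))"
  using assms
proof (induction L arbitrary: k' c)
  case Nil
  then show ?case by (intro exI[of _ "[c]"] exI[of _ "[]"]) auto
next
  case (Cons k L)
  then have step: "\<And>j. c \<le> j \<Longrightarrow> Suc j < c + k \<Longrightarrow> F (e j) = e (j + 2)"
    and last: "F (e (c + k - 1)) = e (c + 1 - k')" and "k \<noteq> 0" by auto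
  have "block_map F e k (c + k) L" "0 \<notin> set L" using Cons.prems by auto
  from Cons.IH[OF this] obtain xs css where len: "map length (xs # css) = cyc_lens L" and ne: "[] \<notin> set (xs # css)"
    and path: "path F (e (c + k)) (map e xs) (e (c + k + 1 - k))"
    and closed: "\<forall>ys\<in>set css. closed_path F (map e ys)"
    and mset: "mset (concat (xs # css)) = mset [c + k..<Suc (c + k + sum_list L)]"
    and lst: "c + k + sum_list L \<in> set (last (xs # css))"
    by (elim exE conjE) (rule that)
  have "[c..<Suc (c + sum_list (k # L))] = [c..<c + k] @ [c + k..<Suc (c + k + sum_list L)]"
    using upt_add_eq_append[of c "c + k" "Suc (sum_list L)"] by (simp add: add.assoc del: upt_Suc mset_upt)
  then have upt: "mset [c..<Suc (c + sum_list (k # L))] = mset [c..<c + k] + mset [c + k..<Suc (c + k + sum_list L)]"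
    by (simp only: mset_append)
  show ?case
  proof (cases "even k")
    case True
    with \<open>k \<noteq> 0\<close> obtain h where k: "k = 2 * Suc h"
      by (metis evenE mult_0_right not0_implies_Suc)
    \<comment> \<open>For even \<open>k\<close> the first parity class leads into the next block,
      and the return at the second place leads through the other class to the exit: all
      \<open>k\<close> letters join one path.\<close>
    define ys where "ys = every_other c (Suc h) @ xs @ every_other (Suc c) h @ [c + k - 1]"
    have "path F (e c) (map e (every_other c (Suc h))) (e (c + k))"
      using path_every_other[of "Suc h" F e c] step k by simp
    moreover have "path F (e (Suc c)) (map e (every_other (Suc c) h)) (e (c + k - 1))"
      using path_every_other[of h F e "Suc c"] step k by simp
    ultimately have "path F (e c) (map e ys) (e (c + 1 - k'))"
      using path last unfolding ys_def map_append path_append by auto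
    moreover have "length ys = length xs + k" by (simp add: ys_def k)
    moreover have "mset ys = mset xs + mset [c..<c + k]"
      using mset_every_other[of c "Suc h"] by (simp add: ys_def k every_other_Suc[of "Suc c"] ac_simps del: upt_Suc mset_upt)
    then have "mset (concat (ys # css)) = mset [c..<Suc (c + sum_list (k # L))]"
      using mset upt by (simp add: ac_simps del: upt_Suc mset_upt sum_list.Cons)
    moreover have "set xs \<subseteq> set ys" by (auto simp: ys_def)
    ultimately show ?thesis
      using len ne closed lst True
      by (intro exI[of _ ys] exI[of _ css]) (auto simp: Let_def add.assoc ys_def simp flip: len)
  next
    case False
    then obtain h where k: "k = 2 * h + 1" by (metis oddE)
    \<comment> \<open>For odd \<open>k\<close> the class of the first place contains the exit and
      forms the new open path, whereas the other class closes up with the path \<open>xs\<close> of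
      the next block.\<close>
    define ys where "ys = every_other c h @ [c + 2 * h]"
    define zs where "zs = xs @ every_other (Suc c) h"
    have "path F (e c) (map e (every_other c h)) (e (c + 2 * h))"
      using path_every_other[of h F e c] step k by simp
    then have py: "path F (e c) (map e ys) (e (c + 1 - k'))"
      using last k by (auto simp: ys_def path_append)
    have "path F (e (Suc c)) (map e (every_other (Suc c) h)) (e (c + k))"
      using path_every_other[of h F e "Suc c"] step k by simp
    then have "path F (e (c + k)) (map e zs) (e (c + k))"
      using path unfolding zs_def map_append path_append by auto
    then have pz: "closed_path F (map e zs)" by (auto simp: closed_path_def)
    have "mset ys + mset zs = mset xs + mset [c..<c + k]"
      using mset_every_other[of c h] by (simp add: ys_def zs_def k ac_simps del: mset_upt)
    then have "mset (concat (ys # zs # css)) = mset [c..<c + k] + mset (concat (xs # css))"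
      by (simp add: ac_simps del: upt_Suc mset_upt flip: add.assoc[of "mset ys"])
    then have "mset (concat (ys # zs # css)) = mset [c..<Suc (c + sum_list (k # L))]"
      unfolding mset upt .
    moreover have "length ys = Suc k div 2" "length zs = length xs + k div 2"
      by (simp_all add: ys_def zs_def k)
    moreover have "ys \<noteq> []" "zs \<noteq> []" "set xs \<subseteq> set zs" using ne by (auto simp: ys_def zs_def)
    ultimately show ?thesis
      using py pz len ne closed lst False
      by (intro exI[of _ ys] exI[of _ "zs # css"]) (auto simp: Let_def add.assoc simp flip: len)
  qed
qed

subsection \<open>The invariants of a block arrangement\<close>

text \<open>In terms of the word \<open>b'\<close>, which is the bottom row with its two outer letters interchanged,
  \<open>Y\<close> has no exceptional cases: it maps a letter to the successor in \<open>t\<close> of its predecessor in \<open>b'\<close>.\<close>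

context
  fixes p :: "'a::finite pair" and a z :: 'a and w w' t b b' :: "'a list"
  assumes p: "p = pair_of (frame a z (w, w'))" and labelled: "labelled (frame a z (w, w'))"
  defines "t \<equiv> a # w @ [z]" and "b \<equiv> z # w' @ [a]" and "b' \<equiv> a # w' @ [z]"
begin

lemma pair_eq: "fst p = pos t" "snd p = pos b"
  by (simp_all add: p pair_of_def frame_def t_def b_def)

lemma labels: "labels t" "labels b"
  using labelled by (simp_all add: labelled_def frame_def t_def b_def)

lemma lengths: "length t = CARD('a)" "length b = CARD('a)" "CARD('a) = length w' + 2" "length w = length w'"
  using labels_length[OF labels(1)] labels_length[OF labels(2)] by (simp_all add: t_def b_def)

lemma inv_t: "i < length w' + 2 \<Longrightarrow> inv (pos t) (Suc i) = t ! i"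
  and inv_b: "i < length w' + 2 \<Longrightarrow> inv (pos b) (Suc i) = b ! i"
  using inv_pos[OF labels(1)] inv_pos[OF labels(2)] lengths by simp_all

lemma pos_b_nth: "i < length w' + 2 \<Longrightarrow> pos b (b ! i) = Suc i"
  using pos_nth[of b i] labels(2) lengths by (simp add: labels_def)

lemma pos_t_nth: "i < length w' + 2 \<Longrightarrow> pos t (t ! i) = Suc i"
  using pos_nth[of t i] labels(1) lengths by (simp add: labels_def)

lemma inv_ends: "inv (pos t) 1 = a" "inv (pos t) (CARD('a)) = z" "inv (pos b) (CARD('a)) = a"
  using inv_t[of 0] inv_t[of "Suc (length w')"] inv_b[of "Suc (length w')"] lengths
  by (simp_all add: t_def b_def nth_append)

lemma S_perm_z: "S_perm p z = a"
  unfolding S_perm_def Let_def pair_eq using inv_ends(1) by (simp add: b_def pos_Cons)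

text \<open>As \<open>z\<close> opens the bottom row, the exceptional case of \<open>S_perm\<close>
  concerns the second bottom letter and uses \<open>a\<close> as its predecessor instead of
  \<open>z\<close>. In \<open>b'\<close> this letter really follows \<open>a\<close>.\<close>

lemma S_perm_nth:
  assumes "i \<le> length w'"
  shows "S_perm p (b ! Suc i) = t ! pos t (b' ! i)"
proof -
  have pb: "pos b (b ! Suc i) = i + 2" using pos_b_nth[of "Suc i"] assms by simp
  have pz: "pos b z = 1" by (simp add: b_def pos_Cons)
  show ?thesis
  proof (cases i)
    case 0
    have "S_perm p (b ! Suc i) = inv (pos t) (pos t a + 1)"
      unfolding S_perm_def Let_def pair_eq using pb pz inv_ends 0 by simp
    moreover have "pos t a = 1" by (simp add: t_def pos_Cons)
    ultimately show ?thesis using inv_t[of 1] 0 by (simp add: b'_def)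
  next
    case (Suc j)
    have bi: "b ! i = b' ! i" using assms Suc by (simp add: b_def b'_def nth_append)
    have "b ! i \<noteq> z"
      using labels(2) pos_b_nth[of i] pz Suc assms by auto
    then have "b ! i \<in> set (a # w)" using labels(1) by (auto simp: labels_def t_def)
    then have "pos t (b ! i) < length w' + 2"
      using pos_le[of "b ! i" "a # w"] lengths pos_append[of "a # w" "[z]" "b ! i"] by (simp add: t_def)
    then have "inv (pos t) (pos t (b ! i) + 1) = t ! pos t (b ! i)" using inv_t by simp
    moreover have "S_perm p (b ! Suc i) = inv (pos t) (pos t (b ! i) + 1)"
      unfolding S_perm_def Let_def pair_eq using pb pz inv_ends Suc inv_b[of i] assms by simp
    ultimately show ?thesis using bi by simp
  qed
qed

text \<open>The map sends \<open>z\<close> through \<open>a\<close> to the image of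
  \<open>a\<close>, so \<open>z\<close> behaves as if it stood at the end of the bottom row in place
  of \<open>a\<close>.\<close>

lemma Y_map_nth:
  assumes "i \<le> length w'"
  shows "Y_map p (b' ! Suc i) = t ! pos t (b' ! i)"
proof (cases "i = length w'")
  case True
  have "b' ! Suc i = z" "b ! Suc i = a" using True by (simp_all add: b_def b'_def)
  moreover have "pos b z = 1" by (simp add: b_def pos_Cons)
  ultimately show ?thesis
    using S_perm_nth[OF assms] S_perm_z by (simp add: Y_map_def pair_eq)
next
  case False
  then have "b' ! Suc i = b ! Suc i" using assms by (simp add: b_def b'_def nth_append)
  moreover have "pos b (b ! Suc i) \<noteq> 1" using pos_b_nth[of "Suc i"] assms by simp
  ultimately show ?thesis
    using S_perm_nth[OF assms] by (simp add: Y_map_def pair_eq)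
qed

lemma Y_map_step:
  assumes "b' ! Suc i = t ! Suc j" "b' ! i = t ! m" "i \<le> length w'" "m \<le> length w'"
  shows "Y_map p (t ! Suc j) = t ! Suc m"
  using Y_map_nth[OF assms(3)] pos_t_nth[of m] assms by simp

text \<open>In a reversed block the predecessor in \<open>b'\<close> is the successor in
  \<open>t\<close>, whose own successor lies two places ahead of the start. Only the last top letter
  of a block, being its first in \<open>b'\<close>, has its predecessor outside: the first top
  letter of the preceding block, or \<open>a\<close> if there is none.\<close>

lemma block_map_Y_map:
  assumes "w = concat (pre @ bs)" "w' = concat (map rev (pre @ bs))" "[] \<notin> set (pre @ bs)"
    and "b' ! length (concat pre) = t ! (length (concat pre) + 1 - k')" "1 \<le> k'"
  shows "block_map (Y_map p) (\<lambda>j. t ! Suc j) k' (length (concat pre)) (map length bs)"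
  using assms
proof (induction bs arbitrary: pre k')
  case Nil
  let ?c = "length (concat pre)"
  have c: "?c = length w'" using Nil lengths by simp
  have "b' ! Suc ?c = t ! Suc ?c" using c lengths by (simp add: b'_def t_def nth_append)
  from Y_map_step[OF this Nil.prems(4)] c Nil.prems(5) show ?case by simp
next
  case (Cons B bs)
  define c k where "c = length (concat pre)" "k = length B"
  have c': "length (concat (map rev pre)) = c" by (simp add: c_k_def length_concat comp_def)
  have k: "1 \<le> k" using Cons.prems(3) by (cases B) (auto simp: c_k_def)
  have w: "w = concat pre @ B @ concat bs" "w' = concat (map rev pre) @ rev B @ concat (map rev bs)"
    using Cons.prems(1,2) by simp_all
  have le: "c + k \<le> length w'" using lengths(4) by (simp add: w c_k_def)
  \<comment> \<open>The places are shifted by one because \<open>a\<close> opens both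
    \<open>t\<close> and \<open>b'\<close>.\<close>
  have mirror: "b' ! Suc (c + i) = t ! (c + k - i)" if "i < k" for i
  proof -
    have "b' ! Suc (c + i) = w' ! (c + i)" using that le by (simp add: b'_def nth_append)
    also have "\<dots> = B ! (k - 1 - i)"
      using that c' by (simp add: w(2) nth_append rev_nth c_k_def(2))
    also have "\<dots> = w ! (c + (k - 1 - i))"
    proof -
      have "k - 1 - i < length B" using that by (simp add: c_k_def)
      then show ?thesis
        unfolding w(1) c_k_def(1) nth_append_length_plus by (simp only: nth_append if_True)
    qed
    also have "\<dots> = t ! (c + k - i)"
    proof -
      have "c + k - i = Suc (c + (k - 1 - i))" "c + (k - 1 - i) < length w"
        using that le lengths(4) by linarith+
      then show ?thesis by (simp only: t_def nth_Cons_Suc nth_append if_True)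
    qed
    finally show ?thesis .
  qed
  have "Y_map p (t ! Suc j) = t ! Suc (j + 2)" if "c \<le> j" "Suc j < c + k" for j
  proof -
    define i where "i = c + k - 2 - j"
    have i: "Suc i < k" "c + k - Suc i = Suc j" "c + k - i = j + 2"
      using that by (simp_all add: i_def)
    show ?thesis
      using Y_map_step[of "c + Suc i" j "j + 2"] mirror[of "Suc i"] mirror[of i] i le that by simp
  qed
  moreover have "Y_map p (t ! Suc (c + k - 1)) = t ! Suc (c + 1 - k')"
  proof (rule Y_map_step[of c])
    show "b' ! Suc c = t ! Suc (c + k - 1)" using mirror[of 0] k by simp
    show "b' ! c = t ! (c + 1 - k')" using Cons.prems(4) by (simp add: c_k_def)
    show "c \<le> length w'" "c + 1 - k' \<le> length w'" using le k Cons.prems(5) by linarith+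
  qed
  moreover have "block_map (Y_map p) (\<lambda>j. t ! Suc j) k (c + k) (map length bs)"
  proof -
    have "b' ! (c + k) = t ! (c + k + 1 - k)"
      using mirror[of "k - 1"] k by simp
    then show ?thesis
      using Cons.IH[of "pre @ [B]" k] Cons.prems(1-3) k by (simp add: c_k_def)
  qed
  ultimately show ?case by (simp add: c_k_def)
qed

lemma cycles_of_blocks:
  assumes "w = concat bs" "w' = concat (map rev bs)" "[] \<notin> set bs"
  shows "\<exists>dss. map length dss = cyc_lens (map length bs) \<and> [] \<notin> set dss \<and> dss \<noteq> [] \<and>
    (\<forall>ys\<in>set dss. closed_path (Y_map p) ys) \<and> mset (concat dss) = mset (w @ [z]) \<and> z \<in> set (last dss)"
proof -
  let ?L = "map length bs" and ?e = "\<lambda>j. t ! Suc j"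
  have "block_map (Y_map p) ?e 1 0 ?L"
    using block_map_Y_map[of "[]" bs 1] assms by (simp add: b'_def t_def)
  moreover have "0 \<notin> set ?L" using assms(3) by auto
  ultimately have "\<exists>xs css. map length (xs # css) = cyc_lens ?L \<and> [] \<notin> set (xs # css) \<and>
      path (Y_map p) (?e 0) (map ?e xs) (?e (0 + 1 - 1)) \<and>
      (\<forall>ys\<in>set css. closed_path (Y_map p) (map ?e ys)) \<and>
      mset (concat (xs # css)) = mset [0..<Suc (0 + sum_list ?L)] \<and>
      0 + sum_list ?L \<in> set (last (xs # css))"
    by (rule block_map_cycles)
  then obtain xs css where len: "map length (xs # css) = cyc_lens ?L" and ne: "[] \<notin> set (xs # css)"
    and path: "path (Y_map p) (?e 0) (map ?e xs) (?e (0 + 1 - 1))"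
    and closed: "\<forall>ys\<in>set css. closed_path (Y_map p) (map ?e ys)"
    and mset: "mset (concat (xs # css)) = mset [0..<Suc (0 + sum_list ?L)]"
    and lst: "0 + sum_list ?L \<in> set (last (xs # css))"
    by (elim exE conjE) (rule that)
  have N: "sum_list ?L = length w" by (simp add: assms(1) length_concat)
  define dss where "dss = map (map ?e) (xs # css)"
  have "map ?e [0..<Suc (length w)] = w @ [z]"
    by (rule nth_equalityI) (simp_all add: t_def del: upt_Suc)
  moreover have "concat dss = map ?e (concat (xs # css))" by (simp add: dss_def map_concat)
  ultimately have "mset (concat dss) = mset (w @ [z])"
    using mset unfolding N by (metis add_0 mset_map)
  moreover have "?e (length w) = z" by (simp add: t_def)
  then have "z \<in> set (last dss)"
    using lst unfolding N dss_def by (force simp: last_map simp del: list.map)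
  moreover have "closed_path (Y_map p) (map ?e xs)" using path by (auto simp: closed_path_def)
  ultimately show ?thesis
    using len ne closed by (intro exI[of _ dss]) (auto simp: dss_def comp_def)
qed

text \<open>The cycles of \<open>Y\<close> partition all letters except \<open>a\<close>, which
  gives P. The cycle of \<open>S\<close> through \<open>a\<close> is the cycle of \<open>Y\<close>
  through \<open>z\<close> with \<open>a\<close> inserted after \<open>z\<close>, whence the
  additional 1 in M.\<close>

lemma invariants_of_blocks:
  assumes "w = concat bs" "w' = concat (map rev bs)" "[] \<notin> set bs"
  shows "P_inv p = mset (cyc_lens (map length bs)) \<and> M_inv p = Suc (last (cyc_lens (map length bs)))"
proof -
  obtain dss where len: "map length dss = cyc_lens (map length bs)" and ne: "[] \<notin> set dss" "dss \<noteq> []"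
    and closed: "\<And>ys. ys \<in> set dss \<Longrightarrow> closed_path (Y_map p) ys"
    and mset: "mset (concat dss) = mset (w @ [z])" and z: "z \<in> set (last dss)"
    using cycles_of_blocks[OF assms] by blast
  have dist: "distinct (concat dss)" and sets: "set (concat dss) = - {a}"
    using labels(1) mset mset_eq_imp_distinct_iff[OF mset] mset_eq_setD[OF mset]
    by (auto simp: labels_def t_def)
  have orbit: "orbit_of (Y_map p) y = set ys" if "ys \<in> set dss" "y \<in> set ys" for y ys
    using closed[OF that(1)] that(2) orbit_of_cycle unfolding closed_path_def by metis
  have "{orbit_of (Y_map p) y | y. y \<noteq> a} = set ` set dss"
  proof (intro equalityI subsetI)
    fix A assume "A \<in> {orbit_of (Y_map p) y | y. y \<noteq> a}"
    then obtain y where y: "A = orbit_of (Y_map p) y" "y \<noteq> a" by blast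
    then have "y \<in> set (concat dss)" unfolding sets by simp
    then obtain ys where "ys \<in> set dss" "y \<in> set ys" by auto
    with y orbit show "A \<in> set ` set dss" by auto
  next
    fix A assume "A \<in> set ` set dss"
    then obtain ys where ys: "ys \<in> set dss" "A = set ys" by blast
    with ne obtain y where y: "y \<in> set ys" by (cases ys) auto
    have "y \<in> set (concat dss)" using ys y by auto
    then have "y \<noteq> a" unfolding sets by simp
    with orbit[OF ys(1) y] ys(2) show "A \<in> {orbit_of (Y_map p) y | y. y \<noteq> a}" by blast
  qed
  then have orbits: "{orbit_of (Y_map p) y | y. y \<noteq> a} = set (map set dss)" by simp
  have dd: "distinct dss" "\<And>ys. ys \<in> set dss \<Longrightarrow> distinct ys"
    "\<And>ys zs. ys \<in> set dss \<Longrightarrow> zs \<in> set dss \<Longrightarrow> ys \<noteq> zs \<Longrightarrow> set ys \<inter> set zs = {}"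
    using dist ne(1) unfolding distinct_concat_iff by (auto simp: removeAll_id)
  have "inj_on set (set dss)"
    using dd(3) ne(1) by (intro inj_onI) (metis inf.idem set_empty2)
  then have "distinct (map set dss)" using dd(1) by (simp add: distinct_map)
  then have "P_inv p = image_mset card (mset (map set dss))"
    unfolding P_inv_def pair_eq inv_ends(1) orbits by (simp only: mset_set_set)
  also have "\<dots> = mset (map card (map set dss))" by (simp only: mset_map)
  also have "map card (map set dss) = map length dss" using dd(2) by (simp add: distinct_card)
  finally have P: "P_inv p = mset (cyc_lens (map length bs))" by (simp add: len)
  have ld: "last dss \<in> set dss" using ne(2) by simp
  from closed[OF ld] obtain x where "path (Y_map p) x (last dss) x" by (auto simp: closed_path_def)
  from cycle_rotate[OF this z] obtain ys where ys: "path (Y_map p) z (z # ys) z"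
    "mset (z # ys) = mset (last dss)" by blast
  have "distinct (z # ys)" using dd(2)[OF ld] mset_eq_imp_distinct_iff[OF ys(2)] by simp
  moreover have "set (z # ys) \<subseteq> - {a}"
    using mset_eq_setD[OF ys(2)] ld sets by auto
  ultimately have dis: "distinct (a # ys @ [z])" by auto
  have S_Y: "S_perm p y = Y_map p y" if "y \<noteq> z" for y
    using that by (simp add: Y_map_def pair_eq b_def pos_Cons)
  have "path (S_perm p) x xs y" if "path (Y_map p) x xs y" "z \<notin> set xs" for x xs y
    using that by (induction xs arbitrary: x) (auto simp: S_Y)
  moreover have "path (Y_map p) (Y_map p z) ys z" using ys(1) by simp
  ultimately have "path (S_perm p) (Y_map p z) ys z" using dis by simp
  moreover have "Y_map p z = S_perm p a" using S_perm_z by (simp add: Y_map_def pair_eq b_def pos_Cons)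
  ultimately have "path (S_perm p) a (a # ys @ [z]) a" using S_perm_z by (auto simp: path_append)
  from orbit_of_cycle_start[OF this] have "M_inv p = card (set (a # ys @ [z]))"
    unfolding M_inv_def pair_eq inv_ends(1) by simp
  also have "\<dots> = Suc (length (z # ys))" using distinct_card[OF dis] by simp
  also have "length (z # ys) = length (last dss)" using mset_eq_length[OF ys(2)] .
  also have "\<dots> = last (cyc_lens (map length bs))" using ne(2) by (simp add: last_map flip: len)
  finally show ?thesis using P by simp
qed

end

lemma invariants_arranged:
  assumes "arranged p L" "0 \<notin> set L"
  shows "P_inv p = mset (cyc_lens L)" "M_inv p = Suc (last (cyc_lens L))"
proof -
  from assms(1) obtain a z bs where "map length bs = L" "p = pair_of (frame a z (block_words bs))"
    "labelled (frame a z (block_words bs))" by (auto simp: arranged_def)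
  moreover from this assms(2) have "[] \<notin> set bs" by force
  ultimately show "P_inv p = mset (cyc_lens L)" "M_inv p = Suc (last (cyc_lens L))"
    using invariants_of_blocks[of p a z "concat bs" "concat (map rev bs)" bs] by (auto simp: block_words_def)
qed

subsection \<open>Piece-wise order reversing pairs\<close>

lemma labels_inv_row:
  fixes f :: "'a::finite \<Rightarrow> nat"
  assumes "bij_betw f UNIV {1..CARD('a)}"
  shows "labels (map (inv f) [1..<Suc (CARD('a))])" "pos (map (inv f) [1..<Suc (CARD('a))]) = f"
proof -
  let ?t = "map (inv f) [1..<Suc (CARD('a))]"
  have "bij_betw (inv f) {1..CARD('a)} UNIV" using bij_betw_inv_into[OF assms] .
  then show l: "labels ?t"
    by (simp add: labels_def distinct_map bij_betw_def atLeastLessThanSuc_atLeastAtMost del: upt_Suc)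
  show "pos ?t = f"
  proof
    fix x
    have "f x \<in> {1..CARD('a)}" "inj f" using assms by (auto simp: bij_betw_def)
    then have "?t ! (f x - 1) = x" "f x - 1 < length ?t" "1 \<le> f x" by (auto simp del: upt_Suc)
    with pos_nth[of ?t "f x - 1"] l show "pos ?t x = f x" by (simp add: labels_def del: upt_Suc)
  qed
qed

lemma concat_intervals:
  assumes "sorted_wrt (<) ks" "m < length ks"
  shows "concat (map (\<lambda>i. map g [ks ! (i - 1)..<ks ! i]) [1..<Suc m]) = map g [ks ! 0..<ks ! m]"
  using assms(2)
proof (induction m)
  case (Suc m)
  have "ks ! 0 \<le> ks ! m"
    using assms(1) Suc.prems by (cases m) (auto simp: sorted_wrt_iff_nth_less less_imp_le)
  moreover have "ks ! m < ks ! Suc m"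
    using assms(1) Suc.prems by (simp add: sorted_wrt_iff_nth_less)
  ultimately have "[ks ! 0..<ks ! Suc m] = [ks ! 0..<ks ! m] @ [ks ! m..<ks ! Suc m]"
    using upt_add_eq_append[of "ks ! 0" "ks ! m" "ks ! Suc m - ks ! m"] by simp
  with Suc show ?case by simp
qed simp

text \<open>The cuts run from 2 to n, so the blocks fill the places 2 to n - 1 of both rows, and
  standardness supplies the crossed outer letters.\<close>

lemma arranged_pwor_cuts:
  fixes p :: "'a::finite pair"
  assumes n: "2 \<le> CARD('a)" and p: "is_pair p" and st: "standard p" and ks: "pwor_cuts p ks"
  shows "arranged p (block_sizes ks)" "0 \<notin> set (block_sizes ks)"
proof -
  define n g g' where "n = CARD('a)" "g = inv (fst p)" "g' = inv (snd p)"
  have bij: "bij_betw (fst p) UNIV {1..n}" "bij_betw (snd p) UNIV {1..n}"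
    using p by (simp_all add: is_pair_def n_g_g'_def)
  have k: "ks \<noteq> []" "ks ! 0 = 2" "ks ! (length ks - 1) = n" and sorted: "sorted_wrt (<) ks"
    using ks by (auto simp: pwor_cuts_def n_g_g'_def hd_conv_nth last_conv_nth)
  have rev: "{x. fst p x \<in> {ks ! (i - 1)..<ks ! i}} = {x. snd p x \<in> {ks ! (i - 1)..<ks ! i}}"
    "\<And>x. fst p x \<in> {ks ! (i - 1)..<ks ! i} \<Longrightarrow> fst p x + snd p x = ks ! (i - 1) + ks ! i - 1"
    if "1 \<le> i" "i < length ks" for i
    using ks that unfolding pwor_cuts_def by blast+
  have mono: "ks ! i \<le> ks ! j" if "i \<le> j" "j < length ks" for i j
    using sorted that by (cases "i = j") (auto simp: sorted_wrt_iff_nth_less less_imp_le)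
  define B where "B i = map g [ks ! (i - 1)..<ks ! i]" for i
  have revB: "rev (B i) = map g' [ks ! (i - 1)..<ks ! i]" if i: "1 \<le> i" "i < length ks" for i
  proof (rule nth_equalityI)
    fix j assume "j < length (rev (B i))"
    then have j: "j < ks ! i - ks ! (i - 1)" by (simp add: B_def)
    \<comment> \<open>The top place that corresponds to place \<open>j\<close> of the reversed
      block; the constant sum of places sends it to bottom place
      \<open>ks ! (i - 1) + j\<close>.\<close>
    define m where "m = ks ! i - 1 - j"
    have m: "m \<in> {ks ! (i - 1)..<ks ! i}" using j by (auto simp: m_def)
    have "2 \<le> ks ! (i - 1)" "ks ! i \<le> n" using mono[of 0 "i - 1"] mono[of i "length ks - 1"] k i by auto
    with m have "m \<in> {1..n}" by auto
    then have fm: "fst p (g m) = m"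
      using bij_betw_inv_into_right[OF bij(1)] by (simp add: n_g_g'_def)
    with rev(2)[OF i, of "g m"] m have "m + snd p (g m) = ks ! (i - 1) + ks ! i - 1" by metis
    moreover have "m + j + 1 = ks ! i" using j by (simp add: m_def)
    ultimately have "snd p (g m) = ks ! (i - 1) + j" by linarith
    then have "g' (ks ! (i - 1) + j) = g m"
      using bij_betw_inv_into_left[OF bij(2), of "g m"] by (simp add: n_g_g'_def)
    then show "rev (B i) ! j = map g' [ks ! (i - 1)..<ks ! i] ! j"
      using j by (simp add: B_def rev_nth m_def)
  qed (simp add: B_def)
  define bs where "bs = map B [1..<length ks]"
  have sl: "Suc (length ks - 1) = length ks" using k(1) by simp
  have c1: "concat bs = map g [2..<n]"
    using concat_intervals[OF sorted, of "length ks - 1" g] k by (simp add: bs_def B_def[abs_def] sl)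
  have "map rev bs = map (\<lambda>i. map g' [ks ! (i - 1)..<ks ! i]) [1..<length ks]"
    by (auto simp: bs_def revB)
  then have c2: "concat (map rev bs) = map g' [2..<n]"
    using concat_intervals[OF sorted, of "length ks - 1" g'] k by (simp add: sl)
  have upt: "[1..<Suc n] = 1 # [2..<n] @ [n]"
    using n by (simp add: upt_conv_Cons numeral_2_eq_2 n_g_g'_def)
  have t: "map g [1..<Suc n] = g 1 # concat bs @ [g n]"
    "map g' [1..<Suc n] = g n # concat (map rev bs) @ [g 1]"
    using st unfolding upt c1 c2 by (simp_all add: standard_def n_g_g'_def)
  have "p = pair_of (frame (g 1) (g n) (block_words bs))" "labelled (frame (g 1) (g n) (block_words bs))"
    using labels_inv_row[OF bij(1)[unfolded n_g_g'_def(1)], folded n_g_g'_def, unfolded t]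
      labels_inv_row[OF bij(2)[unfolded n_g_g'_def(1)], folded n_g_g'_def, unfolded t]
    by (simp_all add: pair_of_def labelled_def frame_def block_words_def)
  moreover have "map length bs = block_sizes ks" by (simp add: bs_def block_sizes_def B_def)
  ultimately show "arranged p (block_sizes ks)" by (auto simp: arranged_def)
  have "ks ! (i - 1) < ks ! i" if "1 \<le> i" "i < length ks" for i
    using sorted that by (simp add: sorted_wrt_iff_nth_less)
  then show "0 \<notin> set (block_sizes ks)" by (force simp: block_sizes_def)
qed

theorem theorem4p5:
  fixes p q :: "'a::finite pair"
  assumes "CARD('a) \<ge> 2"
    and "irreducible p" and "irreducible q"
    and "pwor p" and "pwor q"
    and "\<exists>t. has_type t p \<and> has_type t q"
    and "P_inv p = P_inv q" and "M_inv p = M_inv q"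
  shows "nonlabeled_rauzy_class p = nonlabeled_rauzy_class q"
proof -
  from assms(6) obtain t ks ks' where
    ks: "pwor_cuts p ks" "type_of_sizes t (block_sizes ks)" and
    ks': "pwor_cuts q ks'" "type_of_sizes t (block_sizes ks')"
    unfolding has_type_def by blast
  have "is_pair p" "is_pair q" "standard p" "standard q"
    using assms(2-5) by (simp_all add: irreducible_def pwor_def)
  then have arr: "arranged p (block_sizes ks)" "0 \<notin> set (block_sizes ks)"
    "arranged q (block_sizes ks')" "0 \<notin> set (block_sizes ks')"
    using arranged_pwor_cuts[OF assms(1)] ks(1) ks'(1) by blast+
  have "joined (block_sizes ks) (block_sizes ks')"
    using joined_of_type[OF ks(2) ks'(2) arr(2,4)] assms(7,8)
      invariants_arranged[OF arr(1,2)] invariants_arranged[OF arr(3,4)] by simp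
  then show ?thesis by (rule joined_class_eq[OF arr(1,3)])
qed

end
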